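(* Let $(F,\Phi,\Psi):(G,\cdot,\star)\to(G,\circ,\star')$ be any Drinfeld twist between skew braces on a set $G$. Then $(F,\Phi,\Psi)$ can be decomposed as a composition of twists $$(G,\cdot,\star)\longrightarrow(G,\star,\star)\longrightarrow(G,\star',\star')\longrightarrow(G,\circ,\star'),$$ where the first twist is the canonical twist $E_{(G,\cdot,\star)}$, the last is the inverse of the canonical twist $E_{(G,\circ,\star')}$, and the middle one is the twist $T_f$ attached to a family of group isomorphisms $\{f_x:(G,\star)\to(G,\star')\}_{x\in G}$ satisfying $f_x(x)=x$ for all $x\in G$. In particular, there exists a family of group isomorphisms $\{f_x:(G,\star)\to(G,\star')\}_{x\in G}$ satisfying $f_x(x)=x$ such that for all $x,y\in G$ $$F(x,y)=\Big(f_{x\cdot y}(x),\ \underline{\sigma}^{-1}_{f_{x\cdot y}(x)}\big(f_{x\cdot y}(\sigma_x(y))\big)\Big)=\Big(f_{x\cdot y}(x),\ f_{x\cdot y}(x)^{\circ}\circ(x\cdot y)\Big),$$ where $\sigma$ and $\underline{\sigma}$ denote the first-component maps of the braiding operators of $(G,\cdot,\star)$ and $(G,\circ,\star')$ respectively, and $g^{\circ}$ denotes the inverse of $g$ in $(G,\circ)$.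
   Context: For a map $f:G^2\to G^2$, write $f_{12}=f\times\mathrm{id}_G$ and $f_{23}=\mathrm{id}_G\times f$ as maps $G^3\to G^3$. For a group $(G,m,e)$, $m_{12}(x,y,z)=(m(x,y),z)$ and $m_{23}(x,y,z)=(x,m(y,z))$. Juxtaposition of maps denotes composition. A skew (left) brace $(G,\bullet,\ast)$ is a set $G$ with two group structures satisfying $a\bullet(b\ast c)=(a\bullet b)\ast a^{\ast}\ast(a\bullet c)$, where $a^\ast$ is the inverse of $a$ in $(G,\ast)$; $(G,\ast)$ is its additive group. A braiding operator on a group $(G,m,e)$ is a map $r:G^2\to G^2$ satisfying $r(e,g)=(g,e)$, $r(g,e)=(e,g)$; $r m_{12}=m_{23}r_{12}r_{23}$; $r m_{23}=m_{12}r_{23}r_{12}$; and $mr=m$. Skew braces are equivalent to groups with braiding operators: $(G,\bullet,\ast)$ corresponds to the group $(G,\bullet)$ with braiding operator $r(x,y)=(\sigma_x(y),\gamma_y(x))$, where $\sigma_x(y)=x^{\ast}\ast(x\bullet y)$ and $\sigma_x(y)\bullet\gamma_y(x)=x\bullet y$; conversely $x\ast y=x\bullet\sigma_x^{-1}(y)$. For a group $(G,\star)$, the trivial skew brace $(G,\star,\star)$ has braiding operator $(x,y)\mapsto(y,y^{\star}\star x\star y)$. A Drinfeld twist on a group $(G,m,e)$ with braiding operator $r$ is a triple of invertible maps $F:G^2\to G^2$, $\Phi,\Psi:G^3\to G^3$ satisfying (T1) $F_{12}\Psi=F_{23}\Phi$, (T2) $\Phi r_{23}=r_{23}\Phi$,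 (T3) $\Psi r_{12}=r_{12}\Psi$, and, for all $x,y,z\in G$, (G1) $\Psi(x,y,e)=(x,y,e)$, $\Phi(e,x,y)=(e,x,y)$; (G2) $F(e,x)=(e,x)$, $F(x,e)=(x,e)$; (G3) $m_{23}\Phi(x,y,z)=F(x,m(y,z))$; (G4) $m_{12}\Psi(x,y,z)=F(m(x,y),z)$. It is regarded as a morphism from the skew brace corresponding to $(G,m,e,r)$ to the one corresponding to $(G,mF^{-1},e,FrF^{-1})$. The composite of $(F,\Phi,\Psi)$ followed by $(\mathbf F,\phi,\psi)$ is $(\mathbf F F,\ F_{23}^{-1}\phi F_{23}\Phi,\ F_{12}^{-1}\psi F_{12}\Psi)$ and the inverse of $(F,\Phi,\Psi)$ is $(F^{-1},F_{23}\Phi^{-1}F_{23}^{-1},F_{12}\Psi^{-1}F_{12}^{-1})$. Canonical twist: for a skew brace $(G,\bullet,\ast)$ with braiding operator $r(x,y)=(\sigma_x(y),\gamma_y(x))$, $E_{(G,\bullet,\ast)}:(G,\bullet,\ast)\to(G,\ast,\ast)$ is the triple $F(x,y)=(x,\sigma_x(y))$, $\Phi(x,y,z)=(x,\sigma_x(y),\sigma_{\gamma_y(x)}(z))$, $\Psi(x,y,z)=(x,y,\sigma_x(\sigma_y(z)))$. Twist attached to a family: for a family of group isomorphisms $f=\{f_x:(G,\star)\to(G,\star')\}_{x\in G}$ with $f_x(x)=x$, $T_f:(G,\star,\star)\to(G,\star',\star')$ is the triple (writing products in $(G,\star)$ by juxtaposition) $F(x,y)=(f_{xy}(x),f_{xy}(y))$,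 $\Phi(x,y,z)=(f_{xyz}(x),\alpha_{x,yz}(y),\alpha_{x,yz}(z))$, $\Psi(x,y,z)=(\beta_{xy,z}(x),\beta_{xy,z}(y),f_{xyz}(z))$, where $\alpha_{x,y}=f^{-1}_{f_{xy}(y)}f_{xy}$ and $\beta_{x,y}=f^{-1}_{f_{xy}(x)}f_{xy}$. *)

theory Defs
  imports "HOL-Algebra.Group"
begin

text \<open>All groups are \<open>HOL-Algebra\<close> groups whose carrier is the same set \<open>G\<close>.  Maps
  \<open>G\<^sup>2 \<rightarrow> G\<^sup>2\<close> and \<open>G\<^sup>3 \<rightarrow> G\<^sup>3\<close> are HOL functions whose values outside the carrier are irrelevant:
  every equation between them is imposed on \<open>G\<close> only, and inverses are taken by \<^const>\<open>inv_into\<close>.\<close>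

definition lift12 :: "('a \<times> 'a \<Rightarrow> 'a \<times> 'a) \<Rightarrow> 'a \<times> 'a \<times> 'a \<Rightarrow> 'a \<times> 'a \<times> 'a" where
  "lift12 f = (\<lambda>(x, y, z). (fst (f (x, y)), snd (f (x, y)), z))"

definition lift23 :: "('a \<times> 'a \<Rightarrow> 'a \<times> 'a) \<Rightarrow> 'a \<times> 'a \<times> 'a \<Rightarrow> 'a \<times> 'a \<times> 'a" where
  "lift23 f = (\<lambda>(x, y, z). (x, f (y, z)))"

definition mul :: "('a, 'm) monoid_scheme \<Rightarrow> 'a \<times> 'a \<Rightarrow> 'a" where
  "mul M = (\<lambda>(x, y). x \<otimes>\<^bsub>M\<^esub> y)"

definition mul12 :: "('a, 'm) monoid_scheme \<Rightarrow> 'a \<times> 'a \<times> 'a \<Rightarrow> 'a \<times> 'a" where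
  "mul12 M = (\<lambda>(x, y, z). (x \<otimes>\<^bsub>M\<^esub> y, z))"

definition mul23 :: "('a, 'm) monoid_scheme \<Rightarrow> 'a \<times> 'a \<times> 'a \<Rightarrow> 'a \<times> 'a" where
  "mul23 M = (\<lambda>(x, y, z). (x, y \<otimes>\<^bsub>M\<^esub> z))"

locale braided_group = group M for M (structure) +
  fixes r :: "'a \<times> 'a \<Rightarrow> 'a \<times> 'a"
  assumes r_closed: "r \<in> carrier M \<times> carrier M \<rightarrow> carrier M \<times> carrier M"
    and r_one_left: "g \<in> carrier M \<Longrightarrow> r (\<one>, g) = (g, \<one>)"
    and r_one_right: "g \<in> carrier M \<Longrightarrow> r (g, \<one>) = (\<one>, g)"
    and r_mul12: "t \<in> carrier M \<times> carrier M \<times> carrier M \<Longrightarrow>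
      r (mul12 M t) = mul23 M (lift12 r (lift23 r t))"
    and r_mul23: "t \<in> carrier M \<times> carrier M \<times> carrier M \<Longrightarrow>
      r (mul23 M t) = mul12 M (lift23 r (lift12 r t))"
    and mul_r: "p \<in> carrier M \<times> carrier M \<Longrightarrow> mul M (r p) = mul M p"

text \<open>\<open>M\<close> is the multiplicative group \<open>(G, \<bullet>)\<close> and \<open>A\<close> the additive group \<open>(G, \<ast>)\<close> of the skew
  brace \<open>(G, \<bullet>, \<ast>)\<close>; neither group needs to be commutative.\<close>

locale skew_brace = M: group M + A: group A
  for G :: "'a set" and M :: "('a, 'm) monoid_scheme" and A :: "('a, 'n) monoid_scheme" +
  assumes carrier_M: "carrier M = G"
    and carrier_A: "carrier A = G"
    and brace: "\<lbrakk>a \<in> G; b \<in> G; c \<in> G\<rbrakk> \<Longrightarrow>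
      a \<otimes>\<^bsub>M\<^esub> (b \<otimes>\<^bsub>A\<^esub> c) = (a \<otimes>\<^bsub>M\<^esub> b) \<otimes>\<^bsub>A\<^esub> inv\<^bsub>A\<^esub> a \<otimes>\<^bsub>A\<^esub> (a \<otimes>\<^bsub>M\<^esub> c)"

definition sigma :: "('a, 'm) monoid_scheme \<Rightarrow> ('a, 'n) monoid_scheme \<Rightarrow> 'a \<Rightarrow> 'a \<Rightarrow> 'a" where
  "sigma M A x y = inv\<^bsub>A\<^esub> x \<otimes>\<^bsub>A\<^esub> (x \<otimes>\<^bsub>M\<^esub> y)"

text \<open>\<open>gamma M A y x\<close> is \<open>\<gamma>\<^sub>y(x)\<close>, the solution of \<open>\<sigma>\<^sub>x(y) \<bullet> \<gamma>\<^sub>y(x) = x \<bullet> y\<close>.\<close>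

definition gamma :: "('a, 'm) monoid_scheme \<Rightarrow> ('a, 'n) monoid_scheme \<Rightarrow> 'a \<Rightarrow> 'a \<Rightarrow> 'a" where
  "gamma M A y x = inv\<^bsub>M\<^esub> (sigma M A x y) \<otimes>\<^bsub>M\<^esub> (x \<otimes>\<^bsub>M\<^esub> y)"

definition braiding ::
  "('a, 'm) monoid_scheme \<Rightarrow> ('a, 'n) monoid_scheme \<Rightarrow> 'a \<times> 'a \<Rightarrow> 'a \<times> 'a" where
  "braiding M A = (\<lambda>(x, y). (sigma M A x y, gamma M A y x))"

type_synonym 'a twist =
  "('a \<times> 'a \<Rightarrow> 'a \<times> 'a) \<times> ('a \<times> 'a \<times> 'a \<Rightarrow> 'a \<times> 'a \<times> 'a) \<times> ('a \<times> 'a \<times> 'a \<Rightarrow> 'a \<times> 'a \<times> 'a)"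

locale drinfeld_twist = braided_group M r for M (structure) and r +
  fixes F :: "'a \<times> 'a \<Rightarrow> 'a \<times> 'a"
    and \<Phi> \<Psi> :: "'a \<times> 'a \<times> 'a \<Rightarrow> 'a \<times> 'a \<times> 'a"
  assumes bij_F: "bij_betw F (carrier M \<times> carrier M) (carrier M \<times> carrier M)"
    and bij_\<Phi>: "bij_betw \<Phi> (carrier M \<times> carrier M \<times> carrier M) (carrier M \<times> carrier M \<times> carrier M)"
    and bij_\<Psi>: "bij_betw \<Psi> (carrier M \<times> carrier M \<times> carrier M) (carrier M \<times> carrier M \<times> carrier M)"
    and T1: "t \<in> carrier M \<times> carrier M \<times> carrier M \<Longrightarrow> lift12 F (\<Psi> t) = lift23 F (\<Phi> t)"
    and T2: "t \<in> carrier M \<times> carrier M \<times> carrier M \<Longrightarrow> \<Phi> (lift23 r t) = lift23 r (\<Phi> t)"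
    and T3: "t \<in> carrier M \<times> carrier M \<times> carrier M \<Longrightarrow> \<Psi> (lift12 r t) = lift12 r (\<Psi> t)"
    and G1: "\<lbrakk>x \<in> carrier M; y \<in> carrier M\<rbrakk> \<Longrightarrow> \<Psi> (x, y, \<one>) = (x, y, \<one>)"
      "\<lbrakk>x \<in> carrier M; y \<in> carrier M\<rbrakk> \<Longrightarrow> \<Phi> (\<one>, x, y) = (\<one>, x, y)"
    and G2: "x \<in> carrier M \<Longrightarrow> F (\<one>, x) = (\<one>, x)"
      "x \<in> carrier M \<Longrightarrow> F (x, \<one>) = (x, \<one>)"
    and G3: "\<lbrakk>x \<in> carrier M; y \<in> carrier M; z \<in> carrier M\<rbrakk> \<Longrightarrow>
      mul23 M (\<Phi> (x, y, z)) = F (x, y \<otimes> z)"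
    and G4: "\<lbrakk>x \<in> carrier M; y \<in> carrier M; z \<in> carrier M\<rbrakk> \<Longrightarrow>
      mul12 M (\<Psi> (x, y, z)) = F (x \<otimes> y, z)"

text \<open>\<open>brace_twist G M A M' A' T\<close>: \<open>T\<close> is a twist \<open>(G, M, A) \<rightarrow> (G, M', A')\<close>, that is, a twist on the
  braided group of the first skew brace, such that the braided group of the second skew brace
  is \<open>(G, m F\<^sup>-\<^sup>1, e, F r F\<^sup>-\<^sup>1)\<close>.\<close>

definition brace_twist ::
  "'a set \<Rightarrow> ('a, 'm) monoid_scheme \<Rightarrow> ('a, 'n) monoid_scheme \<Rightarrow>
   ('a, 'p) monoid_scheme \<Rightarrow> ('a, 'q) monoid_scheme \<Rightarrow> 'a twist \<Rightarrow> bool" where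
  "brace_twist G M A M' A' = (\<lambda>(F, \<Phi>, \<Psi>).
     skew_brace G M A \<and> skew_brace G M' A' \<and>
     drinfeld_twist M (braiding M A) F \<Phi> \<Psi> \<and>
     (\<forall>p \<in> G \<times> G. mul M' p = mul M (inv_into (G \<times> G) F p)) \<and>
     \<one>\<^bsub>M'\<^esub> = \<one>\<^bsub>M\<^esub> \<and>
     (\<forall>p \<in> G \<times> G. braiding M' A' p = F (braiding M A (inv_into (G \<times> G) F p))))"

text \<open>Composition is written in diagrammatic order: \<open>twist_comp G S T\<close> is \<open>S\<close> followed by \<open>T\<close>.\<close>

definition twist_comp :: "'a set \<Rightarrow> 'a twist \<Rightarrow> 'a twist \<Rightarrow> 'a twist" where
  "twist_comp G = (\<lambda>(F, \<Phi>, \<Psi>) (F', \<Phi>', \<Psi>').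
     (F' \<circ> F,
      inv_into (G \<times> G \<times> G) (lift23 F) \<circ> \<Phi>' \<circ> lift23 F \<circ> \<Phi>,
      inv_into (G \<times> G \<times> G) (lift12 F) \<circ> \<Psi>' \<circ> lift12 F \<circ> \<Psi>))"

definition twist_inv :: "'a set \<Rightarrow> 'a twist \<Rightarrow> 'a twist" where
  "twist_inv G = (\<lambda>(F, \<Phi>, \<Psi>).
     (inv_into (G \<times> G) F,
      lift23 F \<circ> inv_into (G \<times> G \<times> G) \<Phi> \<circ> inv_into (G \<times> G \<times> G) (lift23 F),
      lift12 F \<circ> inv_into (G \<times> G \<times> G) \<Psi> \<circ> inv_into (G \<times> G \<times> G) (lift12 F)))"

definition twist_eq :: "'a set \<Rightarrow> 'a twist \<Rightarrow> 'a twist \<Rightarrow> bool" where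
  "twist_eq G = (\<lambda>(F, \<Phi>, \<Psi>) (F', \<Phi>', \<Psi>').
     (\<forall>p \<in> G \<times> G. F p = F' p) \<and>
     (\<forall>t \<in> G \<times> G \<times> G. \<Phi> t = \<Phi>' t) \<and>
     (\<forall>t \<in> G \<times> G \<times> G. \<Psi> t = \<Psi>' t))"

definition canonical_twist ::
  "('a, 'm) monoid_scheme \<Rightarrow> ('a, 'n) monoid_scheme \<Rightarrow> 'a twist" where
  "canonical_twist M A =
     ((\<lambda>(x, y). (x, sigma M A x y)),
      (\<lambda>(x, y, z). (x, sigma M A x y, sigma M A (gamma M A y x) z)),
      (\<lambda>(x, y, z). (x, y, sigma M A x (sigma M A y z))))"

definition alpha :: "('a, 'n) monoid_scheme \<Rightarrow> ('a \<Rightarrow> 'a \<Rightarrow> 'a) \<Rightarrow> 'a \<Rightarrow> 'a \<Rightarrow> 'a \<Rightarrow> 'a" where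
  "alpha A f x y =
     inv_into (carrier A) (f (f (x \<otimes>\<^bsub>A\<^esub> y) y)) \<circ> f (x \<otimes>\<^bsub>A\<^esub> y)"

definition beta :: "('a, 'n) monoid_scheme \<Rightarrow> ('a \<Rightarrow> 'a \<Rightarrow> 'a) \<Rightarrow> 'a \<Rightarrow> 'a \<Rightarrow> 'a \<Rightarrow> 'a" where
  "beta A f x y =
     inv_into (carrier A) (f (f (x \<otimes>\<^bsub>A\<^esub> y) x)) \<circ> f (x \<otimes>\<^bsub>A\<^esub> y)"

definition family_twist :: "('a, 'n) monoid_scheme \<Rightarrow> ('a \<Rightarrow> 'a \<Rightarrow> 'a) \<Rightarrow> 'a twist" where
  "family_twist A f =
     ((\<lambda>(x, y). (f (x \<otimes>\<^bsub>A\<^esub> y) x, f (x \<otimes>\<^bsub>A\<^esub> y) y)),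
      (\<lambda>(x, y, z). (f (x \<otimes>\<^bsub>A\<^esub> y \<otimes>\<^bsub>A\<^esub> z) x,
                    alpha A f x (y \<otimes>\<^bsub>A\<^esub> z) y, alpha A f x (y \<otimes>\<^bsub>A\<^esub> z) z)),
      (\<lambda>(x, y, z). (beta A f (x \<otimes>\<^bsub>A\<^esub> y) z x, beta A f (x \<otimes>\<^bsub>A\<^esub> y) z y,
                    f (x \<otimes>\<^bsub>A\<^esub> y \<otimes>\<^bsub>A\<^esub> z) z)))"

end

theory Submission
  imports Defs
begin

text \<open>A twist \<open>(F, \<Phi>, \<Psi>)\<close> is determined by the pair \<open>(F, \<Theta>)\<close>, where \<open>\<Theta> = F\<^sub>2\<^sub>3 \<Phi> = F\<^sub>1\<^sub>2 \<Psi>\<close> is the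
  common value in (T1).  In terms of this pair the axioms say only that \<open>F\<close> and \<open>\<Theta>\<close> intertwine the
  structure maps of the two skew braces: \<open>m' F = m\<close>, \<open>r' F = F r\<close>, \<open>m'\<^sub>1\<^sub>2 \<Theta> = F m\<^sub>1\<^sub>2\<close>, \<open>m'\<^sub>2\<^sub>3 \<Theta> = F m\<^sub>2\<^sub>3\<close>,
  \<open>r'\<^sub>1\<^sub>2 \<Theta> = \<Theta> r\<^sub>1\<^sub>2\<close>, \<open>r'\<^sub>2\<^sub>3 \<Theta> = \<Theta> r\<^sub>2\<^sub>3\<close>, with the corresponding unit laws
  (\<open>brace_twistI\<close>, \<open>brace_twistD\<close>).  Such pairs compose and invert componentwise, and the formulas for
  the composite and the inverse of twists are what componentwise composition and inversion of pairs
  become when translated back to triples (\<open>factors_comp\<close>, \<open>factors_inv\<close>).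

  The canonical twist has \<open>\<Theta>(x, y, z) = (x, \<sigma>\<^sub>x(y), \<sigma>\<^sub>x(\<sigma>\<^sub>y(z)))\<close>.  Conjugating a given twist by the
  canonical twists of its two ends yields an intertwining pair \<open>(F, \<Theta>)\<close> between the trivial skew braces
  \<open>(G, \<star>, \<star>)\<close> and \<open>(G, \<star>', \<star>')\<close>, and it remains to determine all of these (\<open>intertwiner_trivial\<close>).
  The braiding of a trivial skew brace is \<open>(x, y) \<mapsto> (y, y\<^sup>-\<^sup>1 x y)\<close>, so that compatibility with it reads off
  each entry of \<open>F\<close> or \<open>\<Theta>\<close> as a first or last entry after the factors have been permuted.  Hence, for
  \<open>f\<^sub>w(x)\<close> the first entry of \<open>F(x, x\<^sup>-\<^sup>1 w)\<close>, every entry of \<open>F\<close> and of \<open>\<Theta>\<close> is \<open>f\<^sub>w\<close> of the entry in the same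
  place, \<open>w\<close> being the product of all arguments.  The identity \<open>m'\<^sub>1\<^sub>2 \<Theta> = F m\<^sub>1\<^sub>2\<close> now says that each \<open>f\<^sub>w\<close> is
  multiplicative, and \<open>F(w, 1) = (w, 1)\<close> says that \<open>f\<^sub>w(w) = w\<close>.  The same pair \<open>(F, \<Theta>)\<close> belongs to the
  twist \<open>T\<^sub>f\<close>, and undoing the conjugation gives the decomposition and the formulas for \<open>F\<close>.\<close>

section \<open>Maps acting on two adjacent factors\<close>

lemma lift_mem:
  assumes "f \<in> G \<times> G \<rightarrow> G \<times> G" "t \<in> G \<times> G \<times> G"
  shows "lift12 f t \<in> G \<times> G \<times> G" "lift23 f t \<in> G \<times> G \<times> G"
  using assms by (auto simp: lift12_def lift23_def Pi_iff mem_Times_iff split: prod.splits)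

lemma lift_cong:
  assumes "\<And>p. p \<in> G \<times> G \<Longrightarrow> f p = g p" "t \<in> G \<times> G \<times> G"
  shows "lift12 f t = lift12 g t" "lift23 f t = lift23 g t"
  using assms by (auto simp: lift12_def lift23_def)

lemma lift_comp: "lift12 f (lift12 g t) = lift12 (f \<circ> g) t" "lift23 f (lift23 g t) = lift23 (f \<circ> g) t"
  by (cases t; simp add: lift12_def lift23_def)+

lemma lift_id: "(\<And>p. p \<in> G \<times> G \<Longrightarrow> f p = p) \<Longrightarrow> t \<in> G \<times> G \<times> G \<Longrightarrow> lift12 f t = t"
  "(\<And>p. p \<in> G \<times> G \<Longrightarrow> f p = p) \<Longrightarrow> t \<in> G \<times> G \<times> G \<Longrightarrow> lift23 f t = t"
  by (auto simp: lift12_def lift23_def)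

lemma bij_betw_lift:
  assumes "bij_betw F (G \<times> G) (G \<times> G)"
  shows "bij_betw (lift12 F) (G \<times> G \<times> G) (G \<times> G \<times> G)"
    and "bij_betw (lift23 F) (G \<times> G \<times> G) (G \<times> G \<times> G)"
proof -
  let ?I = "inv_into (G \<times> G) F"
  have F: "F \<in> G \<times> G \<rightarrow> G \<times> G" and I: "?I \<in> G \<times> G \<rightarrow> G \<times> G"
    using assms bij_betw_inv_into[OF assms] by (auto dest: bij_betwE)
  have inv: "p \<in> G \<times> G \<Longrightarrow> ?I (F p) = p" "p \<in> G \<times> G \<Longrightarrow> F (?I p) = p" for p
    using assms by (simp_all add: bij_betw_inv_into_left bij_betw_inv_into_right)
  show "bij_betw (lift12 F) (G \<times> G \<times> G) (G \<times> G \<times> G)"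
    by (rule bij_betw_byWitness[where f' = "lift12 ?I"])
      (use lift_mem(1)[OF F] lift_mem(1)[OF I] inv in
        \<open>simp_all add: image_subset_iff lift_comp lift_id[of G] del: mem_Sigma_iff split_paired_All\<close>)
  show "bij_betw (lift23 F) (G \<times> G \<times> G) (G \<times> G \<times> G)"
    by (rule bij_betw_byWitness[where f' = "lift23 ?I"])
      (use lift_mem(2)[OF F] lift_mem(2)[OF I] inv in
        \<open>simp_all add: image_subset_iff lift_comp lift_id[of G] del: mem_Sigma_iff split_paired_All\<close>)
qed

lemma lift_inj:
  assumes "bij_betw F (G \<times> G) (G \<times> G)" "t \<in> G \<times> G \<times> G" "u \<in> G \<times> G \<times> G"
  shows "lift12 F t = lift12 F u \<longleftrightarrow> t = u" "lift23 F t = lift23 F u \<longleftrightarrow> t = u"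
  using assms(2,3) by (simp_all only: bij_betw_lift[OF assms(1), THEN bij_betw_imp_inj_on, THEN inj_on_eq_iff])

lemma mul_lift_commute:
  assumes "\<And>p. p \<in> G \<times> G \<Longrightarrow> mul M' (F p) = mul M p" "t \<in> G \<times> G \<times> G"
  shows "mul12 M' (lift12 F t) = mul12 M t" "mul23 M' (lift23 F t) = mul23 M t"
  using assms(2) assms(1)[of "(fst t, fst (snd t))"] assms(1)[of "snd t"]
  by (auto simp: mul_def mul12_def mul23_def lift12_def lift23_def case_prod_beta)

lemma lift_commute:
  assumes "\<And>p. p \<in> G \<times> G \<Longrightarrow> f (g p) = h (k p)" "t \<in> G \<times> G \<times> G"
  shows "lift12 f (lift12 g t) = lift12 h (lift12 k t)" "lift23 f (lift23 g t) = lift23 h (lift23 k t)"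
  unfolding lift_comp using assms by (auto intro: lift_cong[of G])

section \<open>The maps \<sigma> of a skew brace\<close>

context skew_brace
begin

lemmas carriers = carrier_M carrier_A

lemma M_closed [simp, intro]: "\<lbrakk>x \<in> G; y \<in> G\<rbrakk> \<Longrightarrow> x \<otimes>\<^bsub>M\<^esub> y \<in> G"
  using M.m_closed by (simp add: carriers)

lemma A_closed [simp, intro]: "\<lbrakk>x \<in> G; y \<in> G\<rbrakk> \<Longrightarrow> x \<otimes>\<^bsub>A\<^esub> y \<in> G"
  using A.m_closed by (simp add: carriers)

lemma M_inv_closed [simp, intro]: "x \<in> G \<Longrightarrow> inv\<^bsub>M\<^esub> x \<in> G"
  using M.inv_closed by (simp add: carriers)

lemma A_inv_closed [simp, intro]: "x \<in> G \<Longrightarrow> inv\<^bsub>A\<^esub> x \<in> G"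
  using A.inv_closed by (simp add: carriers)

lemma one_closed [simp, intro]: "\<one>\<^bsub>M\<^esub> \<in> G"
  using M.one_closed by (simp add: carriers)

lemma one_eq: "\<one>\<^bsub>M\<^esub> = \<one>\<^bsub>A\<^esub>"
proof -
  have "\<one>\<^bsub>A\<^esub> = inv\<^bsub>A\<^esub> \<one>\<^bsub>M\<^esub>"
    using brace[of "\<one>\<^bsub>M\<^esub>" "\<one>\<^bsub>A\<^esub>" "\<one>\<^bsub>A\<^esub>"] A.one_closed by (simp add: carriers)
  then show ?thesis
    by (metis A.inv_inv A.inv_one carrier_A one_closed)
qed

lemma mult_eq_add_sigma: "\<lbrakk>x \<in> G; y \<in> G\<rbrakk> \<Longrightarrow> x \<otimes>\<^bsub>A\<^esub> sigma M A x y = x \<otimes>\<^bsub>M\<^esub> y"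
  by (simp add: sigma_def carriers A.inv_solve_left' flip: A.m_assoc)

lemma sigma_closed [simp, intro]: "\<lbrakk>x \<in> G; y \<in> G\<rbrakk> \<Longrightarrow> sigma M A x y \<in> G"
  by (simp add: sigma_def)

lemma gamma_closed [simp, intro]: "\<lbrakk>x \<in> G; y \<in> G\<rbrakk> \<Longrightarrow> gamma M A y x \<in> G"
  by (simp add: gamma_def)

lemma sigma_mult_gamma:
  "\<lbrakk>x \<in> G; y \<in> G\<rbrakk> \<Longrightarrow> sigma M A x y \<otimes>\<^bsub>M\<^esub> gamma M A y x = x \<otimes>\<^bsub>M\<^esub> y"
  by (simp add: gamma_def carriers flip: M.m_assoc)

text \<open>With \<open>sigma_mult\<close>, this says that \<open>\<sigma>\<close> is an action of the multiplicative group on the additive group by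
  automorphisms; the additivity is the brace identity multiplied by \<open>x\<^sup>*\<close> on the left.\<close>

lemma sigma_add:
  assumes "x \<in> G" "y \<in> G" "z \<in> G"
  shows "sigma M A x (y \<otimes>\<^bsub>A\<^esub> z) = sigma M A x y \<otimes>\<^bsub>A\<^esub> sigma M A x z"
  using assms by (simp add: sigma_def brace carriers A.m_assoc)

lemma sigma_one [simp]: "x \<in> G \<Longrightarrow> sigma M A x \<one>\<^bsub>M\<^esub> = \<one>\<^bsub>M\<^esub>"
  by (simp add: sigma_def carriers) (simp add: one_eq carriers)

lemma sigma_one_left [simp]: "x \<in> G \<Longrightarrow> sigma M A \<one>\<^bsub>M\<^esub> x = x"
  by (simp add: sigma_def carriers) (simp add: one_eq carriers)

lemma sigma_mult:
  assumes "x \<in> G" "y \<in> G" "z \<in> G"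
  shows "sigma M A (x \<otimes>\<^bsub>M\<^esub> y) z = sigma M A x (sigma M A y z)"
proof -
  have "(x \<otimes>\<^bsub>M\<^esub> y) \<otimes>\<^bsub>A\<^esub> sigma M A x (sigma M A y z)
      = x \<otimes>\<^bsub>A\<^esub> sigma M A x (y \<otimes>\<^bsub>A\<^esub> sigma M A y z)"
    using assms by (simp add: sigma_add mult_eq_add_sigma[symmetric, of x y] carriers A.m_assoc)
  also have "\<dots> = (x \<otimes>\<^bsub>M\<^esub> y) \<otimes>\<^bsub>A\<^esub> sigma M A (x \<otimes>\<^bsub>M\<^esub> y) z"
    using assms by (simp add: mult_eq_add_sigma carriers M.m_assoc)
  finally show ?thesis
    using assms by (simp add: carriers)
qed

lemma sigma_inverse [simp]:
  assumes "x \<in> G" "y \<in> G"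
  shows "sigma M A (inv\<^bsub>M\<^esub> x) (sigma M A x y) = y" "sigma M A x (sigma M A (inv\<^bsub>M\<^esub> x) y) = y"
  using assms by (simp_all add: carriers flip: sigma_mult)

lemma bij_betw_sigma: "x \<in> G \<Longrightarrow> bij_betw (sigma M A x) G G"
  by (rule bij_betw_byWitness[where f' = "sigma M A (inv\<^bsub>M\<^esub> x)"]) auto

lemma braiding_closed [simp, intro]: "p \<in> G \<times> G \<Longrightarrow> braiding M A p \<in> G \<times> G"
  by (auto simp: braiding_def)

lemma mul_lift_closed: "t \<in> G \<times> G \<times> G \<Longrightarrow> mul12 M t \<in> G \<times> G" "t \<in> G \<times> G \<times> G \<Longrightarrow> mul23 M t \<in> G \<times> G"
  by (auto simp: mul12_def mul23_def)

lemma braiding_lift_closed: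
  assumes "t \<in> G \<times> G \<times> G"
  shows "lift12 (braiding M A) t \<in> G \<times> G \<times> G" "lift23 (braiding M A) t \<in> G \<times> G \<times> G"
  using assms by (auto intro!: lift_mem)

lemmas closure = mul_lift_closed braiding_closed braiding_lift_closed

text \<open>After the identification of \<open>(x, y)\<close> with \<open>(x, \<sigma>\<^sub>x(y))\<close>, the braiding becomes conjugation in the
  additive group.\<close>

lemma sigma_sigma_gamma:
  assumes "x \<in> G" "y \<in> G"
  shows "sigma M A (sigma M A x y) (gamma M A y x)
    = inv\<^bsub>A\<^esub> (sigma M A x y) \<otimes>\<^bsub>A\<^esub> x \<otimes>\<^bsub>A\<^esub> sigma M A x y"
  using assms unfolding sigma_def[of M A "sigma M A x y"]
  by (simp add: sigma_mult_gamma mult_eq_add_sigma[symmetric, of x y] carriers A.m_assoc)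

lemma trivial_skew_brace: "skew_brace G A A"
  by unfold_locales (simp_all add: carriers A.m_assoc, simp add: carriers flip: A.m_assoc)

end

section \<open>Trivial skew braces\<close>

lemma sigma_trivial:
  assumes "skew_brace G A A" "x \<in> G" "y \<in> G"
  shows "sigma A A x y = y"
proof -
  interpret skew_brace G A A by fact
  show ?thesis using assms by (simp add: sigma_def carriers flip: M.m_assoc)
qed

lemma braiding_trivial:
  assumes "skew_brace G A A" "x \<in> G" "y \<in> G"
  shows "braiding A A (x, y) = (y, inv\<^bsub>A\<^esub> y \<otimes>\<^bsub>A\<^esub> x \<otimes>\<^bsub>A\<^esub> y)"
proof -
  interpret skew_brace G A A by fact
  show ?thesis using assms by (simp add: braiding_def gamma_def sigma_trivial carriers M.m_assoc)
qed

lemma braided_group_trivial: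
  assumes "skew_brace G A A"
  shows "braided_group A (braiding A A)"
proof -
  interpret skew_brace G A A by fact
  have cancel: "inv\<^bsub>A\<^esub> z \<otimes>\<^bsub>A\<^esub> (z \<otimes>\<^bsub>A\<^esub> x) = x" "z \<otimes>\<^bsub>A\<^esub> (inv\<^bsub>A\<^esub> z \<otimes>\<^bsub>A\<^esub> x) = x" if "x \<in> G" "z \<in> G" for x z
    using that by (simp_all add: carriers flip: M.m_assoc)
  show ?thesis
    by unfold_locales
      (auto simp: carriers braiding_trivial[OF assms] lift12_def lift23_def mul_def mul12_def mul23_def
        M.m_assoc M.inv_mult_group cancel)
qed

section \<open>Twists as intertwining pairs\<close>

text \<open>The pair \<open>(F, \<Theta>)\<close> replaces the triple \<open>(F, \<Phi>, \<Psi>)\<close>, with \<open>\<Theta> = F\<^sub>2\<^sub>3 \<Phi> = F\<^sub>1\<^sub>2 \<Psi>\<close>.  The laws \<open>mult12\<close> and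
  \<open>mult23\<close> are (G4) and (G3) after \<open>m = m' F\<close> has been applied to one factor; \<open>braid23\<close> and \<open>braid12\<close> are
  (T2) and (T3) after composition with \<open>F\<^sub>2\<^sub>3\<close> and \<open>F\<^sub>1\<^sub>2\<close>; \<open>unit12\<close> and \<open>unit23\<close> are the two halves of (G1).\<close>

locale intertwiner = S: skew_brace G M A + T: skew_brace G M' A'
  for G :: "'a set" and M :: "('a, 'm) monoid_scheme" and A :: "('a, 'n) monoid_scheme"
    and M' :: "('a, 'p) monoid_scheme" and A' :: "('a, 'q) monoid_scheme" +
  fixes F :: "'a \<times> 'a \<Rightarrow> 'a \<times> 'a" and \<Theta> :: "'a \<times> 'a \<times> 'a \<Rightarrow> 'a \<times> 'a \<times> 'a"
  assumes bij2: "bij_betw F (G \<times> G) (G \<times> G)"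
    and bij3: "bij_betw \<Theta> (G \<times> G \<times> G) (G \<times> G \<times> G)"
    and one: "\<one>\<^bsub>M'\<^esub> = \<one>\<^bsub>M\<^esub>"
    and mult: "p \<in> G \<times> G \<Longrightarrow> mul M' (F p) = mul M p"
    and braid: "p \<in> G \<times> G \<Longrightarrow> braiding M' A' (F p) = F (braiding M A p)"
    and mult12: "t \<in> G \<times> G \<times> G \<Longrightarrow> mul12 M' (\<Theta> t) = F (mul12 M t)"
    and mult23: "t \<in> G \<times> G \<times> G \<Longrightarrow> mul23 M' (\<Theta> t) = F (mul23 M t)"
    and braid12: "t \<in> G \<times> G \<times> G \<Longrightarrow> lift12 (braiding M' A') (\<Theta> t) = \<Theta> (lift12 (braiding M A) t)"
    and braid23: "t \<in> G \<times> G \<times> G \<Longrightarrow> lift23 (braiding M' A') (\<Theta> t) = \<Theta> (lift23 (braiding M A) t)"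
    and unit: "p \<in> {\<one>\<^bsub>M\<^esub>} \<times> G \<union> G \<times> {\<one>\<^bsub>M\<^esub>} \<Longrightarrow> F p = p"
    and unit12: "t \<in> G \<times> G \<times> {\<one>\<^bsub>M\<^esub>} \<Longrightarrow> \<Theta> t = lift12 F t"
    and unit23: "t \<in> {\<one>\<^bsub>M\<^esub>} \<times> G \<times> G \<Longrightarrow> \<Theta> t = lift23 F t"
begin

lemma closed2: "p \<in> G \<times> G \<Longrightarrow> F p \<in> G \<times> G"
  using bij2 by (rule bij_betwE[rule_format])

lemma closed3: "t \<in> G \<times> G \<times> G \<Longrightarrow> \<Theta> t \<in> G \<times> G \<times> G"
  using bij3 by (rule bij_betwE[rule_format])

end

lemma intertwiner_cong:
  assumes "intertwiner G M A M' A' F \<Theta>"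
    and F: "\<And>p. p \<in> G \<times> G \<Longrightarrow> F' p = F p" and \<Theta>: "\<And>t. t \<in> G \<times> G \<times> G \<Longrightarrow> \<Theta>' t = \<Theta> t"
  shows "intertwiner G M A M' A' F' \<Theta>'"
proof -
  interpret intertwiner G M A M' A' F \<Theta> by fact
  note lift = lift_cong[of G F' F, OF F]
  show ?thesis
  proof (unfold_locales, goal_cases)
    case 1 then show ?case using bij2 F by (simp cong: bij_betw_cong)
  next
    case 2 then show ?case using bij3 \<Theta> by (simp cong: bij_betw_cong)
  next
    case (10 p) then have "p \<in> G \<times> G" by auto
    then show ?case using unit[OF 10] F by simp
  next
    case (11 t) then have "t \<in> G \<times> G \<times> G" by auto
    then show ?case using unit12[OF 11] \<Theta> lift by simp
  next
    case (12 t) then have "t \<in> G \<times> G \<times> G" by auto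
    then show ?case using unit23[OF 12] \<Theta> lift by simp
  qed (simp_all add: S.closure one mult braid mult12 mult23 braid12 braid23 F \<Theta> del: mem_Sigma_iff)
qed

lemma intertwiner_comp:
  assumes "intertwiner G M A M' A' F \<Theta>" "intertwiner G M' A' M'' A'' F' \<Theta>'"
  shows "intertwiner G M A M'' A'' (F' \<circ> F) (\<Theta>' \<circ> \<Theta>)"
proof -
  interpret I: intertwiner G M A M' A' F \<Theta> by fact
  interpret J: intertwiner G M' A' M'' A'' F' \<Theta>' by fact
  show ?thesis
  proof (unfold_locales, goal_cases)
    case 1 show ?case by (rule bij_betw_trans[OF I.bij2 J.bij2])
  next
    case 2 show ?case by (rule bij_betw_trans[OF I.bij3 J.bij3])
  next
    case (11 t)
    then have "lift12 F t \<in> G \<times> G \<times> {\<one>\<^bsub>M'\<^esub>}"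
      using I.closed2 I.one by (auto simp: lift12_def mem_Times_iff split: prod.splits)
    then show ?case using I.unit12[OF 11] J.unit12 by (simp add: lift_comp del: mem_Sigma_iff)
  next
    case (12 t)
    then have "lift23 F t \<in> {\<one>\<^bsub>M'\<^esub>} \<times> G \<times> G"
      using I.closed2 I.one by (auto simp: lift23_def mem_Times_iff split: prod.splits)
    then show ?case using I.unit23[OF 12] J.unit23 by (simp add: lift_comp del: mem_Sigma_iff)
  qed (simp_all add: I.closed2 I.closed3 I.one J.one I.mult I.braid I.mult12 I.mult23 I.braid12 I.braid23 I.unit
      J.mult J.braid J.mult12 J.mult23 J.braid12 J.braid23 J.unit[unfolded I.one]
      del: mem_Sigma_iff Un_iff)
qed

lemma intertwiner_inv:
  assumes "intertwiner G M A M' A' F \<Theta>"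
  shows "intertwiner G M' A' M A (inv_into (G \<times> G) F) (inv_into (G \<times> G \<times> G) \<Theta>)"
proof -
  interpret intertwiner G M A M' A' F \<Theta> by fact
  let ?I = "inv_into (G \<times> G) F" and ?J = "inv_into (G \<times> G \<times> G) \<Theta>"
  have I: "?I (F p) = p" if "p \<in> G \<times> G" for p using bij_betw_inv_into_left[OF bij2 that] .
  have J: "?J (\<Theta> t) = t" if "t \<in> G \<times> G \<times> G" for t using bij_betw_inv_into_left[OF bij3 that] .
  have preimage2: "\<exists>q \<in> G \<times> G. p = F q" if "p \<in> G \<times> G" for p
    using bij_betw_imp_surj_on[OF bij2] that by blast
  have preimage3: "\<exists>u \<in> G \<times> G \<times> G. t = \<Theta> u" if "t \<in> G \<times> G \<times> G" for t
    using bij_betw_imp_surj_on[OF bij3] that by blast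
  have fixed: "?I p = p" if "p \<in> {\<one>\<^bsub>M\<^esub>} \<times> G \<union> G \<times> {\<one>\<^bsub>M\<^esub>}" for p
  proof -
    have "p \<in> G \<times> G" using that by auto
    then show ?thesis using I[of p] unit[OF that] by simp
  qed
  have closedI: "?I p \<in> G \<times> G" if "p \<in> G \<times> G" for p
    using preimage2[OF that] I by auto
  have right: "lift12 F (lift12 ?I t) = t" "lift23 F (lift23 ?I t) = t" if "t \<in> G \<times> G \<times> G" for t
    using that bij_betw_inv_into_right[OF bij2] by (simp_all add: lift_comp lift_id[of G] del: mem_Sigma_iff)
  show ?thesis
  proof (unfold_locales, goal_cases)
    case 1 show ?case by (rule bij_betw_inv_into[OF bij2])
  next
    case 2 show ?case by (rule bij_betw_inv_into[OF bij3])
  next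
    case 3 show ?case using one by simp
  next
    case (4 p)
    obtain q where "q \<in> G \<times> G" "p = F q" using preimage2[OF 4] by blast
    then show ?case by (simp add: I J mult S.closure del: mem_Sigma_iff)
  next
    case (5 p)
    obtain q where "q \<in> G \<times> G" "p = F q" using preimage2[OF 5] by blast
    then show ?case by (simp add: I J braid S.closure del: mem_Sigma_iff)
  next
    case (6 t)
    obtain u where "u \<in> G \<times> G \<times> G" "t = \<Theta> u" using preimage3[OF 6] by blast
    then show ?case by (simp add: I J mult12 S.closure del: mem_Sigma_iff)
  next
    case (7 t)
    obtain u where "u \<in> G \<times> G \<times> G" "t = \<Theta> u" using preimage3[OF 7] by blast
    then show ?case by (simp add: I J mult23 S.closure del: mem_Sigma_iff)
  next
    case (8 t)
    obtain u where "u \<in> G \<times> G \<times> G" "t = \<Theta> u" using preimage3[OF 8] by blast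
    then show ?case by (simp add: I J braid12 S.closure del: mem_Sigma_iff)
  next
    case (9 t)
    obtain u where "u \<in> G \<times> G \<times> G" "t = \<Theta> u" using preimage3[OF 9] by blast
    then show ?case by (simp add: I J braid23 S.closure del: mem_Sigma_iff)
  next
    case (10 p) then show ?case using fixed one by simp
  next
    case (11 t)
    let ?u = "lift12 ?I t"
    have u: "?u \<in> G \<times> G \<times> {\<one>\<^bsub>M\<^esub>}" and t: "t \<in> G \<times> G \<times> G"
      using 11 closedI one by (auto simp: lift12_def mem_Times_iff split: prod.splits)
    have "?u \<in> G \<times> G \<times> G" using u by auto
    then show ?case using J[of ?u] unit12[OF u] right(1)[OF t] by simp
  next
    case (12 t)
    let ?u = "lift23 ?I t"
    have u: "?u \<in> {\<one>\<^bsub>M\<^esub>} \<times> G \<times> G" and t: "t \<in> G \<times> G \<times> G"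
      using 12 closedI one by (auto simp: lift23_def mem_Times_iff split: prod.splits)
    have "?u \<in> G \<times> G \<times> G" using u by auto
    then show ?case using J[of ?u] unit23[OF u] right(2)[OF t] by simp
  qed
qed

section \<open>The canonical pair and the braiding of a skew brace\<close>

text \<open>Every law reduces to the facts that \<open>\<sigma>\<close> acts by additive automorphisms and that
  \<open>x \<bullet> y = x \<ast> \<sigma>\<^sub>x(y)\<close>; for the two braiding laws the image of the braiding is a conjugation by
  \<open>sigma_sigma_gamma\<close>, and \<open>\<sigma>\<^sub>x\<close> commutes with forming conjugates.\<close>

lemma (in skew_brace) canonical_intertwiner:
  "intertwiner G M A A A (\<lambda>(x, y). (x, sigma M A x y))
    (\<lambda>(x, y, z). (x, sigma M A x y, sigma M A x (sigma M A y z)))"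
  (is "intertwiner _ _ _ _ _ ?F ?\<Theta>")
proof -
  interpret T: skew_brace G A A by (rule trivial_skew_brace)
  note trivial = braiding_trivial[OF trivial_skew_brace]
  have conj: "inv\<^bsub>A\<^esub> (sigma M A x z) \<otimes>\<^bsub>A\<^esub> sigma M A x y \<otimes>\<^bsub>A\<^esub> sigma M A x z
      = sigma M A x (inv\<^bsub>A\<^esub> z \<otimes>\<^bsub>A\<^esub> y \<otimes>\<^bsub>A\<^esub> z)" if "x \<in> G" "y \<in> G" "z \<in> G" for x y z
  proof -
    have "sigma M A x z \<otimes>\<^bsub>A\<^esub> sigma M A x (inv\<^bsub>A\<^esub> z) = \<one>\<^bsub>A\<^esub>"
      using that sigma_one[of x] by (simp add: one_eq carriers flip: sigma_add)
    then have "sigma M A x (inv\<^bsub>A\<^esub> z) = inv\<^bsub>A\<^esub> (sigma M A x z)"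
      using that by (metis A.inv_equality A.inv_inv carriers(2) A_inv_closed sigma_closed)
    then show ?thesis using that by (simp add: sigma_add)
  qed
  show ?thesis
  proof (unfold_locales, goal_cases)
    case 1 show ?case
      by (rule bij_betw_byWitness[where f' = "\<lambda>(x, y). (x, sigma M A (inv\<^bsub>M\<^esub> x) y)"]) auto
  next
    case 2 show ?case
      by (rule bij_betw_byWitness[where f' = "\<lambda>(x, u, v). let y = sigma M A (inv\<^bsub>M\<^esub> x) u in
          (x, y, sigma M A (inv\<^bsub>M\<^esub> y) (sigma M A (inv\<^bsub>M\<^esub> x) v))"]) (auto simp: Let_def)
  next
    case 3 show ?case by (simp add: one_eq)
  next
    case (8 t) then show ?case
      by (auto simp: lift12_def braiding_def[of M A] trivial sigma_sigma_gamma sigma_mult_gamma simp flip: sigma_mult)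
  next
    case (9 t) then show ?case
      by (auto simp: lift23_def braiding_def[of M A] trivial conj sigma_sigma_gamma)
  qed (auto simp: mul_def mul12_def mul23_def lift12_def lift23_def braiding_def[of M A] trivial
      mult_eq_add_sigma sigma_sigma_gamma sigma_mult simp flip: sigma_add)
qed

text \<open>Each axiom for the source becomes the same axiom for the target after \<open>F\<close> is applied to both sides
  and moved inwards, turning into \<open>\<Theta>\<close> on triples.  Since \<open>F\<close> is injective, the axioms can be pulled back.\<close>

lemma (in intertwiner) braided_group_pullback:
  assumes "braided_group M' (braiding M' A')"
  shows "braided_group M (braiding M A)"
proof -
  interpret B: braided_group M' "braiding M' A'" by fact
  have inj: "p = q" if "F p = F q" "p \<in> G \<times> G" "q \<in> G \<times> G" for p q
    using that bij_betw_imp_inj_on[OF bij2] by (metis inj_onD)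
  have fixed: "F (\<one>\<^bsub>M\<^esub>, g) = (\<one>\<^bsub>M\<^esub>, g)" "F (g, \<one>\<^bsub>M\<^esub>) = (g, \<one>\<^bsub>M\<^esub>)" if "g \<in> G" for g
    using that by (auto intro!: unit)
  have "braiding M A \<in> carrier M \<times> carrier M \<rightarrow> carrier M \<times> carrier M"
    using S.braiding_closed by (auto simp only: S.carriers)
  moreover have "braiding M A (\<one>\<^bsub>M\<^esub>, g) = (g, \<one>\<^bsub>M\<^esub>)" if "g \<in> G" for g
  proof (rule inj)
    show "F (braiding M A (\<one>\<^bsub>M\<^esub>, g)) = F (g, \<one>\<^bsub>M\<^esub>)"
      using that B.r_one_left[of g] by (simp add: fixed one T.carriers flip: braid)
  qed (use that S.braiding_closed[of "(\<one>\<^bsub>M\<^esub>, g)"] in simp_all)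
  moreover have "braiding M A (g, \<one>\<^bsub>M\<^esub>) = (\<one>\<^bsub>M\<^esub>, g)" if "g \<in> G" for g
  proof (rule inj)
    show "F (braiding M A (g, \<one>\<^bsub>M\<^esub>)) = F (\<one>\<^bsub>M\<^esub>, g)"
      using that B.r_one_right[of g] by (simp add: fixed one T.carriers flip: braid)
  qed (use that S.braiding_closed[of "(g, \<one>\<^bsub>M\<^esub>)"] in simp_all)
  moreover have "braiding M A (mul12 M t) = mul23 M (lift12 (braiding M A) (lift23 (braiding M A) t))"
    if t: "t \<in> G \<times> G \<times> G" for t
  proof (rule inj)
    have "F (braiding M A (mul12 M t)) = braiding M' A' (mul12 M' (\<Theta> t))"
      using t by (simp only: mult12 braid S.closure)
    also have "\<dots> = mul23 M' (lift12 (braiding M' A') (lift23 (braiding M' A') (\<Theta> t)))"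
      using B.r_mul12[of "\<Theta> t"] closed3[OF t] by (simp only: T.carriers)
    also have "\<dots> = F (mul23 M (lift12 (braiding M A) (lift23 (braiding M A) t)))"
      using t by (simp only: mult23 braid12 braid23 S.closure)
    finally show "F (braiding M A (mul12 M t)) = \<dots>" .
  qed (use t in \<open>simp_all only: S.closure\<close>)
  moreover have "braiding M A (mul23 M t) = mul12 M (lift23 (braiding M A) (lift12 (braiding M A) t))"
    if t: "t \<in> G \<times> G \<times> G" for t
  proof (rule inj)
    have "F (braiding M A (mul23 M t)) = braiding M' A' (mul23 M' (\<Theta> t))"
      using t by (simp only: mult23 braid S.closure)
    also have "\<dots> = mul12 M' (lift23 (braiding M' A') (lift12 (braiding M' A') (\<Theta> t)))"
      using B.r_mul23[of "\<Theta> t"] closed3[OF t] by (simp only: T.carriers)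
    also have "\<dots> = F (mul12 M (lift23 (braiding M A) (lift12 (braiding M A) t)))"
      using t by (simp only: mult12 braid12 braid23 S.closure)
    finally show "F (braiding M A (mul23 M t)) = \<dots>" .
  qed (use t in \<open>simp_all only: S.closure\<close>)
  moreover have "mul M (braiding M A p) = mul M p" if p: "p \<in> G \<times> G" for p
  proof -
    have "mul M (braiding M A p) = mul M' (F (braiding M A p))"
      using p by (simp only: mult S.closure)
    also have "\<dots> = mul M' (F p)"
      using p B.mul_r[of "F p"] closed2[OF p] by (simp only: T.carriers flip: braid)
    finally show ?thesis using p by (simp only: mult)
  qed
  ultimately show ?thesis
    by (intro braided_group.intro braided_group_axioms.intro S.M.is_group) (simp_all only: S.carriers)
qed

text \<open>Along the canonical pair the axioms are inherited from the trivial skew brace on the additive group,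
  where they are identities between conjugates.\<close>

lemma (in skew_brace) braided_group_braiding: "braided_group M (braiding M A)"
  by (rule intertwiner.braided_group_pullback[OF canonical_intertwiner
        braided_group_trivial[OF trivial_skew_brace]])

section \<open>From pairs back to triples\<close>

text \<open>The map \<open>\<Theta>\<close> has two factorizations, through \<open>F\<^sub>2\<^sub>3\<close> and through \<open>F\<^sub>1\<^sub>2\<close>, as in (T1).\<close>

definition factors :: "'a set \<Rightarrow> 'a twist \<Rightarrow> ('a \<times> 'a \<times> 'a \<Rightarrow> 'a \<times> 'a \<times> 'a) \<Rightarrow> bool" where
  "factors G = (\<lambda>(F, \<Phi>, \<Psi>) \<Theta>. bij_betw F (G \<times> G) (G \<times> G) \<and>
     (\<forall>t \<in> G \<times> G \<times> G. \<Phi> t \<in> G \<times> G \<times> G \<and> \<Psi> t \<in> G \<times> G \<times> G \<and>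
       lift23 F (\<Phi> t) = \<Theta> t \<and> lift12 F (\<Psi> t) = \<Theta> t))"

lemma factorsI:
  assumes "bij_betw F (G \<times> G) (G \<times> G)"
    and "\<And>t. t \<in> G \<times> G \<times> G \<Longrightarrow> \<Phi> t \<in> G \<times> G \<times> G" "\<And>t. t \<in> G \<times> G \<times> G \<Longrightarrow> \<Psi> t \<in> G \<times> G \<times> G"
    and "\<And>t. t \<in> G \<times> G \<times> G \<Longrightarrow> lift23 F (\<Phi> t) = \<Theta> t" "\<And>t. t \<in> G \<times> G \<times> G \<Longrightarrow> lift12 F (\<Psi> t) = \<Theta> t"
  shows "factors G (F, \<Phi>, \<Psi>) \<Theta>"
  using assms by (simp add: factors_def del: mem_Sigma_iff split_paired_Ball_Sigma)

lemma factorsD: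
  assumes "factors G (F, \<Phi>, \<Psi>) \<Theta>"
  shows "bij_betw F (G \<times> G) (G \<times> G)"
    and "t \<in> G \<times> G \<times> G \<Longrightarrow> \<Phi> t \<in> G \<times> G \<times> G" "t \<in> G \<times> G \<times> G \<Longrightarrow> \<Psi> t \<in> G \<times> G \<times> G"
    and "t \<in> G \<times> G \<times> G \<Longrightarrow> lift23 F (\<Phi> t) = \<Theta> t" "t \<in> G \<times> G \<times> G \<Longrightarrow> lift12 F (\<Psi> t) = \<Theta> t"
  using assms by (simp_all add: factors_def del: mem_Sigma_iff split_paired_Ball_Sigma)

lemma fst_twist [simp]:
  "fst (twist_comp G S T) = fst T \<circ> fst S" "fst (twist_inv G T) = inv_into (G \<times> G) (fst T)"
  by (simp_all add: twist_comp_def twist_inv_def split: prod.split)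

text \<open>As \<open>F\<^sub>2\<^sub>3\<close> and \<open>F\<^sub>1\<^sub>2\<close> are injective, \<open>F\<close> and \<open>\<Theta>\<close> determine \<open>\<Phi>\<close> and \<open>\<Psi>\<close>.  Equations between twists are
  therefore checked on pairs.\<close>

lemma factors_unique:
  assumes "factors G S \<Theta>" "factors G T \<Theta>'"
    and "\<And>p. p \<in> G \<times> G \<Longrightarrow> fst S p = fst T p" "\<And>t. t \<in> G \<times> G \<times> G \<Longrightarrow> \<Theta> t = \<Theta>' t"
  shows "twist_eq G S T"
proof -
  obtain F \<Phi> \<Psi> where S: "S = (F, \<Phi>, \<Psi>)" by (cases S)
  obtain F' \<Phi>' \<Psi>' where T: "T = (F', \<Phi>', \<Psi>')" by (cases T)
  have F: "F p = F' p" if "p \<in> G \<times> G" for p using assms(3)[OF that] by (simp add: S T)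
  have bij: "bij_betw F (G \<times> G) (G \<times> G)" using assms(1) by (simp add: factors_def S)
  have "\<Phi> t = \<Phi>' t \<and> \<Psi> t = \<Psi>' t" if t: "t \<in> G \<times> G \<times> G" for t
  proof -
    have closed: "\<Phi> t \<in> G \<times> G \<times> G" "\<Psi> t \<in> G \<times> G \<times> G" "\<Phi>' t \<in> G \<times> G \<times> G" "\<Psi>' t \<in> G \<times> G \<times> G"
      using factorsD(2,3)[OF assms(1)[unfolded S] t] factorsD(2,3)[OF assms(2)[unfolded T] t] by simp_all
    have "lift23 F (\<Phi> t) = lift23 F (\<Phi>' t)" "lift12 F (\<Psi> t) = lift12 F (\<Psi>' t)"
      using factorsD(4,5)[OF assms(1)[unfolded S] t] factorsD(4,5)[OF assms(2)[unfolded T] t] assms(4)[OF t]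
        lift_cong(1)[OF F closed(4)] lift_cong(2)[OF F closed(3)] by simp_all
    then show ?thesis using closed by (simp only: lift_inj[OF bij])
  qed
  then show ?thesis using F by (simp add: twist_eq_def S T)
qed

text \<open>The factor \<open>F\<^sub>2\<^sub>3\<^sup>-\<^sup>1\<close> in the second entry of a composite is there to make
  \<open>(F'F)\<^sub>2\<^sub>3 F\<^sub>2\<^sub>3\<^sup>-\<^sup>1 \<Phi>' F\<^sub>2\<^sub>3 \<Phi> = (F'\<^sub>2\<^sub>3 \<Phi>') (F\<^sub>2\<^sub>3 \<Phi>)\<close> hold.\<close>

lemma factors_comp:
  assumes "factors G S \<Theta>" "factors G T \<Theta>'"
  shows "factors G (twist_comp G S T) (\<Theta>' \<circ> \<Theta>)"
proof -
  obtain F \<Phi> \<Psi> where S: "S = (F, \<Phi>, \<Psi>)" by (cases S)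
  obtain F' \<Phi>' \<Psi>' where T: "T = (F', \<Phi>', \<Psi>')" by (cases T)
  have bij: "bij_betw F (G \<times> G) (G \<times> G)" "bij_betw F' (G \<times> G) (G \<times> G)"
    using assms by (simp_all add: factors_def S T)
  note lift = bij_betw_lift[OF bij(1)]
  let ?I12 = "inv_into (G \<times> G \<times> G) (lift12 F)" and ?I23 = "inv_into (G \<times> G \<times> G) (lift23 F)"
  show ?thesis
    unfolding factors_def twist_comp_def S T prod.case
  proof (intro conjI ballI)
    show "bij_betw (F' \<circ> F) (G \<times> G) (G \<times> G)" using bij by (rule bij_betw_trans)
    fix t assume t: "t \<in> G \<times> G \<times> G"
    note u = factorsD[OF assms(1)[unfolded S]]
    have \<Theta>: "\<Theta> t \<in> G \<times> G \<times> G"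
      using bij_betw_apply[OF lift(2) u(2)[OF t]] by (simp only: u(4)[OF t])
    note v = factorsD[OF assms(2)[unfolded T]]
    show "(?I23 \<circ> \<Phi>' \<circ> lift23 F \<circ> \<Phi>) t \<in> G \<times> G \<times> G"
      using bij_betw_apply[OF bij_betw_inv_into[OF lift(2)] v(2)[OF \<Theta>]] by (simp only: u(4)[OF t] comp_apply)
    show "(?I12 \<circ> \<Psi>' \<circ> lift12 F \<circ> \<Psi>) t \<in> G \<times> G \<times> G"
      using bij_betw_apply[OF bij_betw_inv_into[OF lift(1)] v(3)[OF \<Theta>]] by (simp only: u(5)[OF t] comp_apply)
    show "lift23 (F' \<circ> F) ((?I23 \<circ> \<Phi>' \<circ> lift23 F \<circ> \<Phi>) t) = (\<Theta>' \<circ> \<Theta>) t"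
      unfolding lift_comp[symmetric] comp_apply u(4)[OF t] bij_betw_inv_into_right[OF lift(2) v(2)[OF \<Theta>]]
      by (rule v(4)[OF \<Theta>])
    show "lift12 (F' \<circ> F) ((?I12 \<circ> \<Psi>' \<circ> lift12 F \<circ> \<Psi>) t) = (\<Theta>' \<circ> \<Theta>) t"
      unfolding lift_comp[symmetric] comp_apply u(5)[OF t] bij_betw_inv_into_right[OF lift(1) v(3)[OF \<Theta>]]
      by (rule v(5)[OF \<Theta>])
  qed
qed

lemma factors_bij:
  assumes "factors G (F, \<Phi>, \<Psi>) \<Theta>" "bij_betw \<Theta> (G \<times> G \<times> G) (G \<times> G \<times> G)"
  shows "bij_betw \<Phi> (G \<times> G \<times> G) (G \<times> G \<times> G)" "bij_betw \<Psi> (G \<times> G \<times> G) (G \<times> G \<times> G)"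
proof -
  have F: "bij_betw F (G \<times> G) (G \<times> G)" using assms(1) by (simp add: factors_def)
  have *: "bij_betw f (G \<times> G \<times> G) (G \<times> G \<times> G)"
    if "bij_betw g (G \<times> G \<times> G) (G \<times> G \<times> G)" "\<forall>t \<in> G \<times> G \<times> G. f t \<in> G \<times> G \<times> G \<and> g (f t) = \<Theta> t" for f g
  proof (rule bij_betw_comp_iff2[THEN iffD2, OF that(1)])
    show "f ` (G \<times> G \<times> G) \<subseteq> G \<times> G \<times> G" using that(2) by blast
    have "bij_betw (g \<circ> f) (G \<times> G \<times> G) (G \<times> G \<times> G) \<longleftrightarrow> bij_betw \<Theta> (G \<times> G \<times> G) (G \<times> G \<times> G)"
      by (rule bij_betw_cong) (use that(2) in \<open>simp del: mem_Sigma_iff split_paired_Ball_Sigma\<close>)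
    then show "bij_betw (g \<circ> f) (G \<times> G \<times> G) (G \<times> G \<times> G)" using assms(2) by simp
  qed
  show "bij_betw \<Phi> (G \<times> G \<times> G) (G \<times> G \<times> G)"
    by (rule *[OF bij_betw_lift(2)[OF F]]) (use assms(1) in \<open>simp add: factors_def\<close>)
  show "bij_betw \<Psi> (G \<times> G \<times> G) (G \<times> G \<times> G)"
    by (rule *[OF bij_betw_lift(1)[OF F]]) (use assms(1) in \<open>simp add: factors_def\<close>)
qed

lemma factors_inv:
  assumes "factors G T \<Theta>" "bij_betw \<Theta> (G \<times> G \<times> G) (G \<times> G \<times> G)"
  shows "factors G (twist_inv G T) (inv_into (G \<times> G \<times> G) \<Theta>)"
proof -
  obtain F \<Phi> \<Psi> where T: "T = (F, \<Phi>, \<Psi>)" by (cases T)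
  have F: "bij_betw F (G \<times> G) (G \<times> G)" using assms(1) by (simp add: factors_def T)
  note bij = bij_betw_lift[OF F] factors_bij[OF assms[unfolded T]]
  let ?G = "G \<times> G \<times> G"
  show ?thesis
    unfolding factors_def twist_inv_def T prod.case
  proof (intro conjI ballI)
    show "bij_betw (inv_into (G \<times> G) F) (G \<times> G) (G \<times> G)" by (rule bij_betw_inv_into[OF F])
    fix t assume "t \<in> ?G"
    then obtain u where u: "u \<in> ?G" "t = \<Theta> u"
      using bij_betw_imp_surj_on[OF assms(2)] by blast
    note f = factorsD[OF assms(1)[unfolded T]]
    have "inv_into ?G (lift23 F) t = \<Phi> u" "inv_into ?G (lift12 F) t = \<Psi> u"
      using bij_betw_inv_into_left[OF bij(2) f(2)[OF u(1)]] bij_betw_inv_into_left[OF bij(1) f(3)[OF u(1)]]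
      by (simp_all only: f(4,5)[OF u(1)] u(2))
    then have inv: "inv_into ?G \<Theta> t = u" "inv_into ?G \<Phi> (inv_into ?G (lift23 F) t) = u"
        "inv_into ?G \<Psi> (inv_into ?G (lift12 F) t) = u"
      using bij_betw_inv_into_left[OF assms(2) u(1)] bij_betw_inv_into_left[OF bij(3) u(1)]
        bij_betw_inv_into_left[OF bij(4) u(1)] by (simp_all only: u(2))
    have cancel: "lift23 (inv_into (G \<times> G) F) (lift23 F u) = u" "lift12 (inv_into (G \<times> G) F) (lift12 F u) = u"
      using u bij_betw_inv_into_left[OF F] by (simp_all add: lift_comp lift_id[of G] del: mem_Sigma_iff)
    show "(lift23 F \<circ> inv_into ?G \<Phi> \<circ> inv_into ?G (lift23 F)) t \<in> ?G"
      using bij_betw_apply[OF bij(2) u(1)] by (simp only: inv comp_apply)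
    show "(lift12 F \<circ> inv_into ?G \<Psi> \<circ> inv_into ?G (lift12 F)) t \<in> ?G"
      using bij_betw_apply[OF bij(1) u(1)] by (simp only: inv comp_apply)
    show "lift23 (inv_into (G \<times> G) F) ((lift23 F \<circ> inv_into ?G \<Phi> \<circ> inv_into ?G (lift23 F)) t)
        = inv_into ?G \<Theta> t"
      by (simp only: inv cancel comp_apply)
    show "lift12 (inv_into (G \<times> G) F) ((lift12 F \<circ> inv_into ?G \<Psi> \<circ> inv_into ?G (lift12 F)) t)
        = inv_into ?G \<Theta> t"
      by (simp only: inv cancel comp_apply)
  qed
qed

text \<open>The axioms of a twist follow from those of the pair by cancelling the injective maps \<open>F\<^sub>2\<^sub>3\<close> and \<open>F\<^sub>1\<^sub>2\<close>;
  the braided group structure on the source is supplied by \<open>braided_group_braiding\<close>.\<close>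

lemma brace_twistI:
  assumes "factors G T \<Theta>" "intertwiner G M A M' A' (fst T) \<Theta>"
  shows "brace_twist G M A M' A' T"
proof -
  obtain F \<Phi> \<Psi> where T: "T = (F, \<Phi>, \<Psi>)" by (cases T)
  interpret intertwiner G M A M' A' F \<Theta> using assms(2) by (simp add: T)
  let ?G = "G \<times> G \<times> G"
  note f = factorsD(2-)[OF assms(1)[unfolded T]]
  note inj = lift_inj[OF bij2]
  note braid_lift = lift_commute[of G "braiding M' A'" F F "braiding M A", OF braid]
  interpret B: braided_group M "braiding M A" by (rule S.braided_group_braiding)
  have "drinfeld_twist M (braiding M A) F \<Phi> \<Psi>"
  proof (unfold_locales, unfold S.carriers, goal_cases)
    case 1 show ?case by (rule bij2)
  next
    case 2 show ?case by (rule factors_bij(1)[OF assms(1)[unfolded T] bij3])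
  next
    case 3 show ?case by (rule factors_bij(2)[OF assms(1)[unfolded T] bij3])
  next
    case (4 t) then show ?case by (simp only: f)
  next
    case (5 t)
    then have "lift23 F (\<Phi> (lift23 (braiding M A) t)) = lift23 F (lift23 (braiding M A) (\<Phi> t))"
      by (simp only: f S.closure braid23 flip: braid_lift)
    then show ?case using 5 by (subst (asm) inj) (simp_all only: f S.closure)
  next
    case (6 t)
    then have "lift12 F (\<Psi> (lift12 (braiding M A) t)) = lift12 F (lift12 (braiding M A) (\<Psi> t))"
      by (simp only: f S.closure braid12 flip: braid_lift)
    then show ?case using 6 by (subst (asm) inj) (simp_all only: f S.closure)
  next
    case (7 x y)
    then have t: "(x, y, \<one>\<^bsub>M\<^esub>) \<in> ?G" by simp
    then show ?case using 7 inj(1)[OF f(2)[OF t] t] f(4)[OF t] unit12[of "(x, y, \<one>\<^bsub>M\<^esub>)"] by simp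
  next
    case (8 x y)
    then have t: "(\<one>\<^bsub>M\<^esub>, x, y) \<in> ?G" by simp
    then show ?case using 8 inj(2)[OF f(1)[OF t] t] f(3)[OF t] unit23[of "(\<one>\<^bsub>M\<^esub>, x, y)"] by simp
  next
    case (9 x) then show ?case by (intro unit) simp
  next
    case (10 x) then show ?case by (intro unit) simp
  next
    case (11 x y z)
    then have t: "(x, y, z) \<in> ?G" by simp
    have "mul23 M (\<Phi> (x, y, z)) = F (mul23 M (x, y, z))"
      using mul_lift_commute(2)[of G M' F M, OF mult f(1)[OF t]] f(3)[OF t] mult23[OF t] by simp
    then show ?case by (simp add: mul23_def)
  next
    case (12 x y z)
    then have t: "(x, y, z) \<in> ?G" by simp
    have "mul12 M (\<Psi> (x, y, z)) = F (mul12 M (x, y, z))"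
      using mul_lift_commute(1)[of G M' F M, OF mult f(2)[OF t]] f(4)[OF t] mult12[OF t] by simp
    then show ?case by (simp add: mul12_def)
  qed
  moreover have "mul M' p = mul M (inv_into (G \<times> G) F p)
      \<and> braiding M' A' p = F (braiding M A (inv_into (G \<times> G) F p))" if p: "p \<in> G \<times> G" for p
  proof -
    have "inv_into (G \<times> G) F p \<in> G \<times> G" "F (inv_into (G \<times> G) F p) = p"
      using bij_betwE[OF bij_betw_inv_into[OF bij2]] bij_betw_inv_into_right[OF bij2] p by blast+
    then show ?thesis using mult[of "inv_into (G \<times> G) F p"] braid[of "inv_into (G \<times> G) F p"] by simp
  qed
  ultimately show ?thesis
    using one S.skew_brace_axioms T.skew_brace_axioms by (simp add: brace_twist_def T del: mem_Sigma_iff split_paired_All)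
qed

lemma brace_twistD:
  assumes "brace_twist G M A M' A' (F, \<Phi>, \<Psi>)"
  shows "factors G (F, \<Phi>, \<Psi>) (lift23 F \<circ> \<Phi>)" "intertwiner G M A M' A' F (lift23 F \<circ> \<Phi>)"
proof -
  interpret S: skew_brace G M A using assms by (simp add: brace_twist_def)
  interpret T: skew_brace G M' A' using assms by (simp add: brace_twist_def)
  interpret D: drinfeld_twist M "braiding M A" F \<Phi> \<Psi> using assms by (simp add: brace_twist_def)
  let ?G = "G \<times> G \<times> G" and ?\<Theta> = "lift23 F \<circ> \<Phi>"
  note bij = D.bij_F[unfolded S.carriers] D.bij_\<Phi>[unfolded S.carriers] D.bij_\<Psi>[unfolded S.carriers]
  have \<Phi>: "\<Phi> t \<in> ?G" and \<Psi>: "\<Psi> t \<in> ?G" if "t \<in> ?G" for t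
    using that bij bij_betwE by blast+
  have T1: "lift12 F (\<Psi> t) = ?\<Theta> t" if "t \<in> ?G" for t
    using D.T1[unfolded S.carriers, OF that] by simp
  have one: "\<one>\<^bsub>M'\<^esub> = \<one>\<^bsub>M\<^esub>" using assms by (simp add: brace_twist_def)
  have FG: "F p \<in> G \<times> G" "inv_into (G \<times> G) F (F p) = p" if "p \<in> G \<times> G" for p
    using that bij(1) bij_betwE bij_betw_inv_into_left by (blast, metis)
  have mult: "mul M' (F p) = mul M p" and braid: "braiding M' A' (F p) = F (braiding M A p)"
    if "p \<in> G \<times> G" for p
    using assms FG[OF that] unfolding brace_twist_def prod.case by metis+
  show factors: "factors G (F, \<Phi>, \<Psi>) ?\<Theta>"
    by (rule factorsI) (use bij \<Phi> \<Psi> T1 in \<open>simp_all del: mem_Sigma_iff\<close>)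
  note braid_lift = lift_commute[of G "braiding M' A'" F F "braiding M A", OF braid]
  show "intertwiner G M A M' A' F ?\<Theta>"
  proof (unfold_locales, goal_cases)
    case 1 show ?case by (rule bij)
  next
    case 2 show ?case by (rule bij_betw_trans[OF bij(2) bij_betw_lift(2)[OF bij(1)]])
  next
    case 3 show ?case by (rule one)
  next
    case (4 p) then show ?case by (rule mult)
  next
    case (5 p) then show ?case by (rule braid)
  next
    case (6 t)
    have "mul12 M' (lift12 F (\<Psi> t)) = F (mul12 M t)"
      using D.G4 6 mul_lift_commute(1)[of G M' F M, OF mult \<Psi>[OF 6]] by (auto simp: S.carriers mul12_def[of M])
    then show ?case using T1[OF 6] by simp
  next
    case (7 t)
    then show ?case
      using D.G3 mul_lift_commute(2)[of G M' F M, OF mult \<Phi>[OF 7]] by (auto simp: S.carriers mul23_def[of M])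
  next
    case (8 t)
    then have "lift12 (braiding M' A') (lift12 F (\<Psi> t)) = lift12 F (\<Psi> (lift12 (braiding M A) t))"
      by (simp only: braid_lift \<Psi> D.T3[unfolded S.carriers])
    then show ?case using 8 by (simp only: T1 S.closure)
  next
    case (9 t)
    then show ?case
      by (simp only: comp_apply braid_lift \<Phi> D.T2[unfolded S.carriers])
  next
    case (10 p) then show ?case using D.G2 by (auto simp: S.carriers)
  next
    case (11 t)
    then have "t \<in> ?G" "\<Psi> t = t" using D.G1(1) by (auto simp: S.carriers)
    then show ?case using T1[of t] by simp
  next
    case (12 t)
    then have "\<Phi> t = t" using D.G1(2) by (auto simp: S.carriers)
    then show ?case by simp
  qed
qed

lemma brace_twist_inv:
  assumes "factors G T \<Theta>" "intertwiner G M A M' A' (fst T) \<Theta>"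
  shows "brace_twist G M' A' M A (twist_inv G T)"
proof (rule brace_twistI)
  show "factors G (twist_inv G T) (inv_into (G \<times> G \<times> G) \<Theta>)"
    using assms by (intro factors_inv intertwiner.bij3)
  show "intertwiner G M' A' M A (fst (twist_inv G T)) (inv_into (G \<times> G \<times> G) \<Theta>)"
    using intertwiner_inv[OF assms(2)] by simp
qed

section \<open>Intertwining pairs between groups\<close>

text \<open>The bijectivity of \<open>f\<^sub>w\<close> comes from that of \<open>F\<close>: because \<open>m' F = m\<close>, the map \<open>F\<close> restricts to a bijection
  from the pairs with product \<open>w\<close> in \<open>A\<close> to the pairs with product \<open>w\<close> in \<open>A'\<close>, and on either side such a pair is
  determined by its first entry.\<close>

lemma intertwiner_trivial:
  assumes "intertwiner G A A A' A' F \<Theta>"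
  obtains f where "\<And>w. w \<in> G \<Longrightarrow> f w \<in> iso A A'" "\<And>w. w \<in> G \<Longrightarrow> f w w = w"
    and "\<And>x y. \<lbrakk>x \<in> G; y \<in> G\<rbrakk> \<Longrightarrow> F (x, y) = (f (x \<otimes>\<^bsub>A\<^esub> y) x, f (x \<otimes>\<^bsub>A\<^esub> y) y)"
    and "\<And>x y z. \<lbrakk>x \<in> G; y \<in> G; z \<in> G\<rbrakk> \<Longrightarrow> \<Theta> (x, y, z) =
      (f (x \<otimes>\<^bsub>A\<^esub> y \<otimes>\<^bsub>A\<^esub> z) x, f (x \<otimes>\<^bsub>A\<^esub> y \<otimes>\<^bsub>A\<^esub> z) y, f (x \<otimes>\<^bsub>A\<^esub> y \<otimes>\<^bsub>A\<^esub> z) z)"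
proof -
  interpret intertwiner G A A A' A' F \<Theta> by fact
  note trivial = braiding_trivial[OF S.skew_brace_axioms] braiding_trivial[OF T.skew_brace_axioms]
  have cancel: "inv\<^bsub>A\<^esub> x \<otimes>\<^bsub>A\<^esub> (x \<otimes>\<^bsub>A\<^esub> y) = y" "x \<otimes>\<^bsub>A\<^esub> (inv\<^bsub>A\<^esub> x \<otimes>\<^bsub>A\<^esub> y) = y" if "x \<in> G" "y \<in> G" for x y
    using that by (simp_all add: S.carriers flip: S.M.m_assoc)
  define f where "f w x = fst (F (x, inv\<^bsub>A\<^esub> x \<otimes>\<^bsub>A\<^esub> w))" for w x
  have F: "F (x, y) = (f (x \<otimes>\<^bsub>A\<^esub> y) x, f (x \<otimes>\<^bsub>A\<^esub> y) y)" if xy: "x \<in> G" "y \<in> G" for x y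
  proof -
    obtain a b where ab: "F (x, y) = (a, b)" by fastforce
    then have "a \<in> G" "b \<in> G" using closed2[of "(x, y)"] xy by simp_all
    then have "F (y, inv\<^bsub>A\<^esub> y \<otimes>\<^bsub>A\<^esub> x \<otimes>\<^bsub>A\<^esub> y) = (b, inv\<^bsub>A'\<^esub> b \<otimes>\<^bsub>A'\<^esub> a \<otimes>\<^bsub>A'\<^esub> b)"
      using braid[of "(x, y)"] xy by (simp add: trivial ab)
    then show ?thesis using xy ab by (simp add: f_def cancel S.carriers S.M.m_assoc)
  qed
  have \<Theta>: "\<Theta> (x, y, z) =
      (f (x \<otimes>\<^bsub>A\<^esub> y \<otimes>\<^bsub>A\<^esub> z) x, f (x \<otimes>\<^bsub>A\<^esub> y \<otimes>\<^bsub>A\<^esub> z) y, f (x \<otimes>\<^bsub>A\<^esub> y \<otimes>\<^bsub>A\<^esub> z) z)"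
    if xyz: "x \<in> G" "y \<in> G" "z \<in> G" for x y z
  proof -
    have outer: "fst (\<Theta> (x, u, v)) = f (x \<otimes>\<^bsub>A\<^esub> u \<otimes>\<^bsub>A\<^esub> v) x"
        "snd (snd (\<Theta> (x, u, v))) = f (x \<otimes>\<^bsub>A\<^esub> u \<otimes>\<^bsub>A\<^esub> v) v" if uv: "u \<in> G" "v \<in> G" for u v
    proof -
      obtain a b c where abc: "\<Theta> (x, u, v) = (a, b, c)" using prod_cases3 by blast
      show "fst (\<Theta> (x, u, v)) = f (x \<otimes>\<^bsub>A\<^esub> u \<otimes>\<^bsub>A\<^esub> v) x"
        using mult23[of "(x, u, v)"] xyz(1) uv
        by (simp add: mul23_def abc F S.carriers S.M.m_assoc)
      show "snd (snd (\<Theta> (x, u, v))) = f (x \<otimes>\<^bsub>A\<^esub> u \<otimes>\<^bsub>A\<^esub> v) v"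
        using mult12[of "(x, u, v)"] xyz(1) uv by (simp add: mul12_def abc F)
    qed
    \<comment> \<open>The middle entry is the last entry for \<open>(x, u, y)\<close>, where the braiding takes \<open>(u, y)\<close> to \<open>(y, z)\<close>.\<close>
    let ?u = "y \<otimes>\<^bsub>A\<^esub> z \<otimes>\<^bsub>A\<^esub> inv\<^bsub>A\<^esub> y"
    have u: "?u \<in> G" using xyz by simp
    have prod: "x \<otimes>\<^bsub>A\<^esub> ?u \<otimes>\<^bsub>A\<^esub> y = x \<otimes>\<^bsub>A\<^esub> y \<otimes>\<^bsub>A\<^esub> z"
      using xyz by (simp add: S.carriers S.M.m_assoc)
    have "lift23 (braiding A A) (x, ?u, y) = (x, y, z)"
      using xyz by (simp add: lift23_def trivial S.carriers S.M.m_assoc cancel)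
    then have "\<Theta> (x, y, z) = lift23 (braiding A' A') (\<Theta> (x, ?u, y))"
      using braid23[of "(x, ?u, y)"] xyz u by simp
    moreover obtain a b c where abc: "\<Theta> (x, ?u, y) = (a, b, c)" using prod_cases3 by blast
    moreover have "b \<in> G" "c \<in> G" using closed3[of "(x, ?u, y)"] xyz u abc by simp_all
    ultimately have "fst (snd (\<Theta> (x, y, z))) = snd (snd (\<Theta> (x, ?u, y)))"
      by (simp add: lift23_def trivial)
    then show ?thesis using outer(1)[of y z] outer(2)[of y z] outer(2)[of ?u y] xyz u prod
      by (simp add: prod_eq_iff)
  qed
  have closed: "f w x \<in> G" if "w \<in> G" "x \<in> G" for w x
    using closed2[of "(x, inv\<^bsub>A\<^esub> x \<otimes>\<^bsub>A\<^esub> w)"] that by (auto simp: f_def mem_Times_iff)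
  have product: "f w x \<otimes>\<^bsub>A'\<^esub> f w y = w" if "x \<in> G" "y \<in> G" "w = x \<otimes>\<^bsub>A\<^esub> y" for x y w
    using mult[of "(x, y)"] that by (simp add: F mul_def)
  have fixed: "f w w = w" if "w \<in> G" for w
    using unit[of "(w, \<one>\<^bsub>A\<^esub>)"] F[of w "\<one>\<^bsub>A\<^esub>"] that by (simp add: S.carriers)
  have iso: "f w \<in> iso A A'" if w: "w \<in> G" for w
  proof (rule isoI)
    show "f w \<in> hom A A'"
    proof (rule homI)
      fix x y assume xy: "x \<in> carrier A" "y \<in> carrier A"
      show "f w (x \<otimes>\<^bsub>A\<^esub> y) = f w x \<otimes>\<^bsub>A'\<^esub> f w y"
      proof -
        \<comment> \<open>The third argument is chosen to make the total product \<open>w\<close>.\<close>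
        let ?z = "inv\<^bsub>A\<^esub> (x \<otimes>\<^bsub>A\<^esub> y) \<otimes>\<^bsub>A\<^esub> w"
        have z: "?z \<in> G" "x \<otimes>\<^bsub>A\<^esub> y \<otimes>\<^bsub>A\<^esub> ?z = w"
          using xy w by (simp_all add: S.carriers cancel)
        then show ?thesis
          using mult12[of "(x, y, ?z)"] xy by (simp add: S.carriers mul12_def \<Theta> F)
      qed
    qed (use w closed in \<open>simp add: S.carriers T.carriers\<close>)
    show "bij_betw (f w) (carrier A) (carrier A')"
      unfolding S.carriers T.carriers
    proof (rule bij_betw_imageI)
      show "inj_on (f w) G"
      proof (rule inj_onI)
        fix x x' assume x: "x \<in> G" "x' \<in> G" and eq: "f w x = f w x'"
        let ?y = "inv\<^bsub>A\<^esub> x \<otimes>\<^bsub>A\<^esub> w" and ?y' = "inv\<^bsub>A\<^esub> x' \<otimes>\<^bsub>A\<^esub> w"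
        have y: "?y \<in> G" "?y' \<in> G" "x \<otimes>\<^bsub>A\<^esub> ?y = w" "x' \<otimes>\<^bsub>A\<^esub> ?y' = w"
          using x w by (simp_all add: cancel)
        have "f w x \<otimes>\<^bsub>A'\<^esub> f w ?y = f w x \<otimes>\<^bsub>A'\<^esub> f w ?y'"
          using product[OF x(1) y(1)] product[OF x(2) y(2)] y(3,4) by (simp add: eq)
        then have "f w ?y = f w ?y'"
          using closed[OF w] x y by (simp add: T.carriers)
        then have "F (x, ?y) = F (x', ?y')" using x y eq by (simp add: F)
        then show "x = x'"
          using bij_betw_imp_inj_on[OF bij2] x y by (auto dest!: inj_onD)
      qed
      show "f w ` G = G"
      proof
        show "G \<subseteq> f w ` G"
        proof
          fix a assume a: "a \<in> G"
          let ?b = "inv\<^bsub>A'\<^esub> a \<otimes>\<^bsub>A'\<^esub> w"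
          have b: "?b \<in> G" "a \<otimes>\<^bsub>A'\<^esub> ?b = w"
            using a w by (simp_all add: T.carriers flip: T.M.m_assoc)
          then have "(a, ?b) \<in> F ` (G \<times> G)" using bij_betw_imp_surj_on[OF bij2] a by simp
          then obtain x y where xy: "x \<in> G" "y \<in> G" "F (x, y) = (a, ?b)" by auto
          then have "w = x \<otimes>\<^bsub>A\<^esub> y" using mult[of "(x, y)"] b by (simp add: mul_def)
          then have "a = f w x" using xy by (simp add: F)
          then show "a \<in> f w ` G" using xy by blast
        qed
      qed (use closed w in auto)
    qed
  qed
  show thesis by (rule that[OF iso fixed F \<Theta>])
qed

text \<open>For \<open>v = f\<^sub>w(y z)\<close>, the elements \<open>\<alpha>(y) = f\<^sub>v\<^sup>-\<^sup>1 (f\<^sub>w y)\<close> and \<open>\<alpha>(z) = f\<^sub>v\<^sup>-\<^sup>1 (f\<^sub>w z)\<close> have product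
  \<open>f\<^sub>v\<^sup>-\<^sup>1(v) = v\<close>, so that \<open>F\<close> applies \<open>f\<^sub>v\<close> to both of them and returns \<open>(f\<^sub>w y, f\<^sub>w z)\<close>.  The same computation with
  \<open>\<beta>\<close> applies to \<open>\<Psi>\<close>.\<close>

lemma factors_family_twist:
  assumes "skew_brace G A A" "skew_brace G A' A'"
    and iso: "\<And>w. w \<in> G \<Longrightarrow> f w \<in> iso A A'" and fixed: "\<And>w. w \<in> G \<Longrightarrow> f w w = w"
    and bij: "bij_betw (fst (family_twist A f)) (G \<times> G) (G \<times> G)"
  shows "factors G (family_twist A f) (\<lambda>(x, y, z). let w = x \<otimes>\<^bsub>A\<^esub> y \<otimes>\<^bsub>A\<^esub> z in (f w x, f w y, f w z))"
proof -
  interpret S: skew_brace G A A by fact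
  interpret T: skew_brace G A' A' by fact
  have f_bij: "bij_betw (f w) G G" and f_hom: "f w \<in> hom A A'" if "w \<in> G" for w
    using iso[OF that] by (simp_all add: iso_def S.carriers T.carriers)
  have closed: "f w x \<in> G" if "w \<in> G" "x \<in> G" for w x
    using bij_betw_apply[OF f_bij] that by blast
  have hom: "f w (x \<otimes>\<^bsub>A\<^esub> y) = f w x \<otimes>\<^bsub>A'\<^esub> f w y" if "w \<in> G" "x \<in> G" "y \<in> G" for w x y
    using hom_mult[OF f_hom] that by (simp add: S.carriers)
  define g where "g w = inv_into G (f w)" for w
  have g: "g w x \<in> G" "f w (g w x) = x" "g w (f w x) = x" if "w \<in> G" "x \<in> G" for w x
    using that f_bij[OF that(1)] bij_betw_apply[OF bij_betw_inv_into[OF f_bij[OF that(1)]]]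
    by (simp_all add: g_def bij_betw_inv_into_left bij_betw_inv_into_right)
  have g_mult: "g v (f w y) \<otimes>\<^bsub>A\<^esub> g v (f w z) = v" if "w \<in> G" "y \<in> G" "z \<in> G" "v = f w (y \<otimes>\<^bsub>A\<^esub> z)" for v w y z
  proof -
    have v: "v \<in> G" using that closed by simp
    have "f v (g v (f w y) \<otimes>\<^bsub>A\<^esub> g v (f w z)) = v"
      using that v closed g by (simp add: hom)
    then show ?thesis using v g fixed closed that by (metis S.A_closed)
  qed
  show ?thesis
    unfolding family_twist_def
    by (rule factorsI)
      (use bij in \<open>auto simp: family_twist_def lift12_def lift23_def alpha_def beta_def S.carriers Let_def
          closed g g_mult S.M.m_assoc simp flip: g_def\<close>)
qed

section \<open>The decomposition\<close>

lemma (in skew_brace) factors_canonical_twist: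
  "factors G (canonical_twist M A) (\<lambda>(x, y, z). (x, sigma M A x y, sigma M A x (sigma M A y z)))"
  unfolding canonical_twist_def
  by (rule factorsI[OF intertwiner.bij2[OF canonical_intertwiner]])
    (auto simp: lift12_def lift23_def sigma_mult_gamma simp flip: sigma_mult)

theorem corollary2p8:
  fixes G :: "'a set"
    and M :: "('a, 'm) monoid_scheme" and A :: "('a, 'n) monoid_scheme"
    and M' :: "('a, 'p) monoid_scheme" and A' :: "('a, 'q) monoid_scheme"
    and F :: "'a \<times> 'a \<Rightarrow> 'a \<times> 'a"
    and \<Phi> \<Psi> :: "'a \<times> 'a \<times> 'a \<Rightarrow> 'a \<times> 'a \<times> 'a"
  assumes "skew_brace G M A"
    and "skew_brace G M' A'"
    and "brace_twist G M A M' A' (F, \<Phi>, \<Psi>)"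
  shows "\<exists>f. (\<forall>x \<in> G. f x \<in> iso A A' \<and> f x x = x) \<and>
    brace_twist G M A A A (canonical_twist M A) \<and>
    brace_twist G A A A' A' (family_twist A f) \<and>
    brace_twist G A' A' M' A' (twist_inv G (canonical_twist M' A')) \<and>
    twist_eq G (F, \<Phi>, \<Psi>)
      (twist_comp G (twist_comp G (canonical_twist M A) (family_twist A f))
        (twist_inv G (canonical_twist M' A'))) \<and>
    (\<forall>x \<in> G. \<forall>y \<in> G.
      F (x, y) = (f (x \<otimes>\<^bsub>M\<^esub> y) x,
        inv_into G (sigma M' A' (f (x \<otimes>\<^bsub>M\<^esub> y) x)) (f (x \<otimes>\<^bsub>M\<^esub> y) (sigma M A x y))) \<and>
      F (x, y) = (f (x \<otimes>\<^bsub>M\<^esub> y) x,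
        inv\<^bsub>M'\<^esub> (f (x \<otimes>\<^bsub>M\<^esub> y) x) \<otimes>\<^bsub>M'\<^esub> (x \<otimes>\<^bsub>M\<^esub> y)))"
proof -
  let ?E = "canonical_twist M A" and ?E' = "canonical_twist M' A'"
  let ?\<Theta>E = "\<lambda>(x, y, z). (x, sigma M A x y, sigma M A x (sigma M A y z))"
  let ?\<Theta>E' = "\<lambda>(x, y, z). (x, sigma M' A' x y, sigma M' A' x (sigma M' A' y z))"
  let ?\<Theta> = "lift23 F \<circ> \<Phi>"
  interpret S: skew_brace G M A by fact
  interpret T: skew_brace G M' A' by fact
  interpret I: intertwiner G M A M' A' F ?\<Theta> by (rule brace_twistD(2)[OF assms(3)])
  have E: "intertwiner G M A A A (fst ?E) ?\<Theta>E" and E': "intertwiner G M' A' A' A' (fst ?E') ?\<Theta>E'"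
    using S.canonical_intertwiner T.canonical_intertwiner by (simp_all add: canonical_twist_def)
  note IE = intertwiner.bij2[OF E] intertwiner.bij3[OF E] and IE' = intertwiner.bij2[OF E'] intertwiner.bij3[OF E']
  \<comment> \<open>\<open>?H\<close> and \<open>?\<Theta>H\<close> form the conjugate \<open>E' T E\<^sup>-\<^sup>1\<close> of the given pair, now between trivial skew braces.\<close>
  let ?H = "fst ?E' \<circ> (F \<circ> inv_into (G \<times> G) (fst ?E))"
  let ?\<Theta>H = "?\<Theta>E' \<circ> (?\<Theta> \<circ> inv_into (G \<times> G \<times> G) ?\<Theta>E)"
  have H: "intertwiner G A A A' A' ?H ?\<Theta>H"
    by (rule intertwiner_comp[OF intertwiner_comp[OF intertwiner_inv[OF E] I.intertwiner_axioms] E'])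
  obtain f where iso: "\<And>w. w \<in> G \<Longrightarrow> f w \<in> iso A A'" and fixed: "\<And>w. w \<in> G \<Longrightarrow> f w w = w"
    and Hf: "\<And>x y. \<lbrakk>x \<in> G; y \<in> G\<rbrakk> \<Longrightarrow> ?H (x, y) = (f (x \<otimes>\<^bsub>A\<^esub> y) x, f (x \<otimes>\<^bsub>A\<^esub> y) y)"
    and \<Theta>f: "\<And>x y z. \<lbrakk>x \<in> G; y \<in> G; z \<in> G\<rbrakk> \<Longrightarrow> ?\<Theta>H (x, y, z) =
      (f (x \<otimes>\<^bsub>A\<^esub> y \<otimes>\<^bsub>A\<^esub> z) x, f (x \<otimes>\<^bsub>A\<^esub> y \<otimes>\<^bsub>A\<^esub> z) y, f (x \<otimes>\<^bsub>A\<^esub> y \<otimes>\<^bsub>A\<^esub> z) z)"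
    by (rule intertwiner_trivial[OF H]) blast
  let ?T = "family_twist A f"
  let ?\<Theta>T = "\<lambda>(x, y, z). let w = x \<otimes>\<^bsub>A\<^esub> y \<otimes>\<^bsub>A\<^esub> z in (f w x, f w y, f w z)"
  have TH: "fst ?T p = ?H p" if "p \<in> G \<times> G" for p
    using that Hf by (cases p) (simp add: family_twist_def)
  have \<Theta>TH: "?\<Theta>T t = ?\<Theta>H t" if "t \<in> G \<times> G \<times> G" for t
    using that \<Theta>f by (cases t) (simp add: Let_def)
  have T: "intertwiner G A A A' A' (fst ?T) ?\<Theta>T"
    by (rule intertwiner_cong[OF H TH \<Theta>TH])
  have factorsT: "factors G ?T ?\<Theta>T"
    by (rule factors_family_twist[OF S.trivial_skew_brace T.trivial_skew_brace iso fixed intertwiner.bij2[OF T]])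
  let ?D = "twist_comp G (twist_comp G ?E ?T) (twist_inv G ?E')"
  have cancelF: "fst ?D p = F p" if p: "p \<in> G \<times> G" for p
  proof -
    have "fst ?T (fst ?E p) = fst ?E' (F p)"
      using TH[OF bij_betw_apply[OF IE(1) p]] bij_betw_inv_into_left[OF IE(1) p] by simp
    then show ?thesis using bij_betw_inv_into_left[OF IE'(1) I.closed2[OF p]] by simp
  qed
  have cancel\<Theta>: "(inv_into (G \<times> G \<times> G) ?\<Theta>E' \<circ> (?\<Theta>T \<circ> ?\<Theta>E)) t = ?\<Theta> t" if t: "t \<in> G \<times> G \<times> G" for t
  proof -
    have "?\<Theta>T (?\<Theta>E t) = ?\<Theta>E' (?\<Theta> t)"
      using \<Theta>TH[OF bij_betw_apply[OF IE(2) t]] bij_betw_inv_into_left[OF IE(2) t] by (simp only: comp_apply)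
    then show ?thesis using bij_betw_inv_into_left[OF IE'(2) I.closed3[OF t]] by (simp only: comp_apply)
  qed
  have "factors G ?D (inv_into (G \<times> G \<times> G) ?\<Theta>E' \<circ> (?\<Theta>T \<circ> ?\<Theta>E))"
    by (intro factors_comp factors_inv S.factors_canonical_twist T.factors_canonical_twist factorsT IE')
  then have decomposition: "twist_eq G (F, \<Phi>, \<Psi>) ?D"
    by (rule factors_unique[OF brace_twistD(1)[OF assms(3)]]) (simp_all only: cancelF cancel\<Theta> fst_conv)
  have formula: "F (x, y) = (f (x \<otimes>\<^bsub>M\<^esub> y) x,
        inv_into G (sigma M' A' (f (x \<otimes>\<^bsub>M\<^esub> y) x)) (f (x \<otimes>\<^bsub>M\<^esub> y) (sigma M A x y))) \<and>
      F (x, y) = (f (x \<otimes>\<^bsub>M\<^esub> y) x, inv\<^bsub>M'\<^esub> (f (x \<otimes>\<^bsub>M\<^esub> y) x) \<otimes>\<^bsub>M'\<^esub> (x \<otimes>\<^bsub>M\<^esub> y))"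
    if xy: "x \<in> G" "y \<in> G" for x y
  proof -
    obtain a b where ab: "F (x, y) = (a, b)" by fastforce
    then have G: "a \<in> G" "b \<in> G" using I.closed2[of "(x, y)"] xy by simp_all
    have p: "(x, y) \<in> G \<times> G" using xy by simp
    have "fst ?T (fst ?E (x, y)) = fst ?E' (F (x, y))"
      using TH[OF bij_betw_apply[OF IE(1) p]] bij_betw_inv_into_left[OF IE(1) p] by simp
    then have a: "f (x \<otimes>\<^bsub>M\<^esub> y) x = a" and "f (x \<otimes>\<^bsub>M\<^esub> y) (sigma M A x y) = sigma M' A' a b"
      using xy by (simp_all add: family_twist_def canonical_twist_def ab S.mult_eq_add_sigma)
    then have "inv_into G (sigma M' A' a) (f (x \<otimes>\<^bsub>M\<^esub> y) (sigma M A x y)) = b"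
      using bij_betw_inv_into_left[OF T.bij_betw_sigma[OF G(1)] G(2)] by simp
    moreover have "a \<otimes>\<^bsub>M'\<^esub> b = x \<otimes>\<^bsub>M\<^esub> y" using I.mult[OF p] by (simp add: mul_def ab)
    then have "b = inv\<^bsub>M'\<^esub> a \<otimes>\<^bsub>M'\<^esub> (x \<otimes>\<^bsub>M\<^esub> y)"
      using G by (metis T.M.inv_solve_left T.M.m_closed T.carriers(1))
    ultimately show ?thesis by (simp add: a ab)
  qed
  show ?thesis
  proof (intro exI conjI)
    show "\<forall>x \<in> G. f x \<in> iso A A' \<and> f x x = x" using iso fixed by blast
    show "brace_twist G M A A A ?E" by (rule brace_twistI[OF S.factors_canonical_twist E])
    show "brace_twist G A A A' A' ?T" by (rule brace_twistI[OF factorsT T])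
    show "brace_twist G A' A' M' A' (twist_inv G ?E')" by (rule brace_twist_inv[OF T.factors_canonical_twist E'])
    show "twist_eq G (F, \<Phi>, \<Psi>) ?D" by (rule decomposition)
  qed (use formula in blast)
qed

end
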